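(* Let $m^2\ge 0$ and let $\kappa^m$ be the Pedersen metric on the unit ball $B^4_{\mathbb{R}}$ (defined in the context). Then $\kappa^m$ has negative sectional curvature if and only if $m^2<1$. For $m^2>1$ there are negative as well as positive sectional curvatures near the origin $\varrho=0$; for $m^2=1$ there are negative as well as zero sectional curvatures at the origin $\varrho=0$.
   Context: The Pedersen metric on the open unit ball $B^4_{\mathbb{R}}\subset\mathbb{R}^4$ with radial coordinate $\varrho\in[0,1)$ is $$\kappa^m=\frac{1}{(1-\varrho^2)^2}\left(\frac{1+m^2\varrho^2}{1+m^2\varrho^4}\,d\varrho^2+\varrho^2(1+m^2\varrho^2)(\sigma_1^2+\sigma_2^2)+\frac{\varrho^2(1+m^2\varrho^4)}{1+m^2\varrho^2}\,\sigma_3^2\right),$$ extended smoothly over the origin, where $\sigma_1,\sigma_2,\sigma_3$ are the left-invariant $1$-forms on $S^3$ satisfying $d\sigma_i=\sum_{j,k}\varepsilon_{ijk}\,\sigma_j\wedge\sigma_k$ (so e.g. $d\sigma_1=2\sigma_2\wedge\sigma_3$), pulled back to $B^4_{\mathbb{R}}\setminus\{0\}$ by the radial projection. *)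

theory Defs
  imports "HOL-Analysis.Analysis"
begin

section \<open>Sectional curvature in coordinates\<close>

text \<open>
  A Riemannian metric on an open subset of \<open>\<real>\<^sup>n\<close> is given as \<open>g x u v\<close>: the inner product of the
  tangent vectors \<open>u\<close> and \<open>v\<close> at the point \<open>x\<close>.
\<close>

type_synonym 'n metric_field = "real ^ 'n \<Rightarrow> real ^ 'n \<Rightarrow> real ^ 'n \<Rightarrow> real"

definition gram_matrix :: "'n::finite metric_field \<Rightarrow> real ^ 'n \<Rightarrow> real ^ 'n ^ 'n" where
  "gram_matrix g x = (\<chi> i j. g x (axis i 1) (axis j 1))"

definition pderiv_at :: "'n::finite \<Rightarrow> (real ^ 'n \<Rightarrow> real) \<Rightarrow> real ^ 'n \<Rightarrow> real" where
  "pderiv_at i f x = deriv (\<lambda>t. f (x + t *\<^sub>R axis i 1)) 0"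

text \<open>\<open>christoffel g k i j\<close> is \<open>\<Gamma>\<^sup>k\<^sub>i\<^sub>j\<close>, with \<open>\<nabla>\<^sub>i \<partial>\<^sub>j = (\<Sum>k. \<Gamma>\<^sup>k\<^sub>i\<^sub>j \<partial>\<^sub>k)\<close>.\<close>

definition christoffel ::
  "'n::finite metric_field \<Rightarrow> 'n \<Rightarrow> 'n \<Rightarrow> 'n \<Rightarrow> real ^ 'n \<Rightarrow> real" where
  "christoffel g k i j x =
     1 / 2 * (\<Sum>l\<in>UNIV. matrix_inv (gram_matrix g x) $ k $ l *
       (pderiv_at i (\<lambda>y. gram_matrix g y $ j $ l) x
        + pderiv_at j (\<lambda>y. gram_matrix g y $ i $ l) x
        - pderiv_at l (\<lambda>y. gram_matrix g y $ i $ j) x))"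

text \<open>
  \<open>riemann_coeff g l i j k\<close> is the \<open>\<partial>\<^sub>l\<close>-component of \<open>R(\<partial>\<^sub>i,\<partial>\<^sub>j)\<partial>\<^sub>k\<close>, with the sign convention
  \<open>R(X,Y)Z = \<nabla>\<^sub>X \<nabla>\<^sub>Y Z - \<nabla>\<^sub>Y \<nabla>\<^sub>X Z - \<nabla>\<^bsub>[X,Y]\<^esub> Z\<close>.
\<close>

definition riemann_coeff ::
  "'n::finite metric_field \<Rightarrow> 'n \<Rightarrow> 'n \<Rightarrow> 'n \<Rightarrow> 'n \<Rightarrow> real ^ 'n \<Rightarrow> real" where
  "riemann_coeff g l i j k x =
     pderiv_at i (christoffel g l j k) x - pderiv_at j (christoffel g l i k) x
     + (\<Sum>p\<in>UNIV. christoffel g l i p x * christoffel g p j k x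
                - christoffel g l j p x * christoffel g p i k x)"

definition riemann ::
  "'n::finite metric_field \<Rightarrow> real ^ 'n \<Rightarrow> real ^ 'n \<Rightarrow> real ^ 'n \<Rightarrow> real ^ 'n \<Rightarrow> real ^ 'n" where
  "riemann g x u v w =
     (\<chi> l. \<Sum>i\<in>UNIV. \<Sum>j\<in>UNIV. \<Sum>k\<in>UNIV. riemann_coeff g l i j k x * u $ i * v $ j * w $ k)"

definition sectional_curvature ::
  "'n::finite metric_field \<Rightarrow> real ^ 'n \<Rightarrow> real ^ 'n \<Rightarrow> real ^ 'n \<Rightarrow> real" where
  "sectional_curvature g x u v =
     g x (riemann g x u v v) u / (g x u u * g x v v - (g x u v)\<^sup>2)"

text \<open>
  The values of the sectional curvature on all tangent planes at \<open>x\<close>, each plane being represented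
  by its bases. The condition \<open>u \<noteq> v\<close> is needed because \<open>{u, u}\<close> is an independent set if \<open>u \<noteq> 0\<close>.
\<close>

definition sectional_curvatures :: "'n::finite metric_field \<Rightarrow> real ^ 'n \<Rightarrow> real set" where
  "sectional_curvatures g x =
     {sectional_curvature g x u v | u v. u \<noteq> v \<and> independent {u, v}}"

definition negative_sectional_curvature_on ::
  "(real ^ 'n) set \<Rightarrow> 'n::finite metric_field \<Rightarrow> bool" where
  "negative_sectional_curvature_on S g \<longleftrightarrow> (\<forall>x\<in>S. \<forall>K\<in>sectional_curvatures g x. K < 0)"


section \<open>The left-invariant coframe\<close>

text \<open>
  \<open>\<real>\<^sup>4\<close> is identified with the quaternions, the coordinates \<open>1, 2, 3, 4\<close> being the coefficients of
  \<open>1, i, j, k\<close>. On the unit sphere the forms below are the \<open>i, j, k\<close> components of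
  \<open>- q\<^sup>-\<^sup>1 dq\<close>; the minus sign makes the structure equations hold as \<open>d\<sigma>\<^sub>1 = 2 \<sigma>\<^sub>2 \<and> \<sigma>\<^sub>3\<close> etc.
  The formulas are homogeneous of degree \<open>0\<close> in the point and vanish on radial vectors, so
  they also give the pullbacks to \<open>\<real>\<^sup>4 - {0}\<close> by the radial projection \<open>x \<mapsto> x / \<bar>x\<bar>\<close>.
\<close>

definition sigma1 :: "real ^ 4 \<Rightarrow> real ^ 4 \<Rightarrow> real" where
  "sigma1 x u = - (x$1 * u$2 - x$2 * u$1 - x$3 * u$4 + x$4 * u$3) / (norm x)\<^sup>2"

definition sigma2 :: "real ^ 4 \<Rightarrow> real ^ 4 \<Rightarrow> real" where
  "sigma2 x u = - (x$1 * u$3 - x$3 * u$1 - x$4 * u$2 + x$2 * u$4) / (norm x)\<^sup>2"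

definition sigma3 :: "real ^ 4 \<Rightarrow> real ^ 4 \<Rightarrow> real" where
  "sigma3 x u = - (x$1 * u$4 - x$4 * u$1 - x$2 * u$3 + x$3 * u$2) / (norm x)\<^sup>2"

definition quat_mult :: "real ^ 4 \<Rightarrow> real ^ 4 \<Rightarrow> real ^ 4" where
  "quat_mult p q = vector
     [p$1 * q$1 - p$2 * q$2 - p$3 * q$3 - p$4 * q$4,
      p$1 * q$2 + p$2 * q$1 + p$3 * q$4 - p$4 * q$3,
      p$1 * q$3 - p$2 * q$4 + p$3 * q$1 + p$4 * q$2,
      p$1 * q$4 + p$2 * q$3 - p$3 * q$2 + p$4 * q$1]"

lemma norm4_sq: "(norm (x :: real ^ 4))\<^sup>2 = (x$1)\<^sup>2 + (x$2)\<^sup>2 + (x$3)\<^sup>2 + (x$4)\<^sup>2"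
  unfolding power2_norm_eq_inner by (simp add: inner_vec_def sum_4 power2_eq_square)

lemma inner4: "(u :: real ^ 4) \<bullet> v = u$1 * v$1 + u$2 * v$2 + u$3 * v$3 + u$4 * v$4"
  by (simp add: inner_vec_def sum_4)

lemma quat_mult_nth:
  "quat_mult p q $ 1 = p$1 * q$1 - p$2 * q$2 - p$3 * q$3 - p$4 * q$4"
  "quat_mult p q $ 2 = p$1 * q$2 + p$2 * q$1 + p$3 * q$4 - p$4 * q$3"
  "quat_mult p q $ 3 = p$1 * q$3 - p$2 * q$4 + p$3 * q$1 + p$4 * q$2"
  "quat_mult p q $ 4 = p$1 * q$4 + p$2 * q$3 - p$3 * q$2 + p$4 * q$1"
  by (simp_all add: quat_mult_def vector_def)

lemma sigma_left_invariant:
  assumes "norm p = 1"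
  shows "sigma1 (quat_mult p x) (quat_mult p u) = sigma1 x u"
    and "sigma2 (quat_mult p x) (quat_mult p u) = sigma2 x u"
    and "sigma3 (quat_mult p x) (quat_mult p u) = sigma3 x u"
proof -
  have p: "(p$1)\<^sup>2 + (p$2)\<^sup>2 + (p$3)\<^sup>2 + (p$4)\<^sup>2 = 1"
    using assms norm4_sq[of p] by simp
  have n: "(norm (quat_mult p x))\<^sup>2 = (norm x)\<^sup>2"
    using p unfolding norm4_sq quat_mult_nth by algebra
  show "sigma1 (quat_mult p x) (quat_mult p u) = sigma1 x u"
    unfolding sigma1_def n quat_mult_nth
    by (rule arg_cong[where f = "\<lambda>t. t / (norm x)\<^sup>2"]) (use p in algebra)
  show "sigma2 (quat_mult p x) (quat_mult p u) = sigma2 x u"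
    unfolding sigma2_def n quat_mult_nth
    by (rule arg_cong[where f = "\<lambda>t. t / (norm x)\<^sup>2"]) (use p in algebra)
  show "sigma3 (quat_mult p x) (quat_mult p u) = sigma3 x u"
    unfolding sigma3_def n quat_mult_nth
    by (rule arg_cong[where f = "\<lambda>t. t / (norm x)\<^sup>2"]) (use p in algebra)
qed

text \<open>
  The structure equations on \<open>\<real>\<^sup>4 - {0}\<close>, evaluated on constant vector fields \<open>u, v\<close>, for which
  \<open>d\<sigma>(u, v)\<close> is the derivative of \<open>\<sigma>(v)\<close> along \<open>u\<close> minus the derivative of \<open>\<sigma>(u)\<close> along \<open>v\<close>.
\<close>

lemma sigma_deriv_aux:
  fixes x v w :: "real ^ 4"
  assumes "x \<noteq> 0" and L: "\<And>t. L t = L0 + t * L1"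
  shows "((\<lambda>t. - L t / (norm (x + t *\<^sub>R w))\<^sup>2) has_real_derivative
           (- L1 * (norm x)\<^sup>2 + 2 * L0 * (x \<bullet> w)) / ((norm x)\<^sup>2)\<^sup>2) (at 0)"
proof -
  have e: "(norm (x + t *\<^sub>R w))\<^sup>2 = (norm x)\<^sup>2 + 2 * t * (x \<bullet> w) + t\<^sup>2 * (norm w)\<^sup>2" for t
    unfolding power2_norm_eq_inner
    by (simp add: inner_simps power2_eq_square inner_commute algebra_simps)
  show ?thesis
    unfolding e L
    by (rule derivative_eq_intros refl | use assms in simp)+
qed

lemma sigma_structure_equations:
  fixes x u v :: "real ^ 4"
  assumes "x \<noteq> 0"
  defines "d \<equiv> \<lambda>\<sigma> :: real ^ 4 \<Rightarrow> real ^ 4 \<Rightarrow> real.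
      deriv (\<lambda>t. \<sigma> (x + t *\<^sub>R u) v) 0 - deriv (\<lambda>t. \<sigma> (x + t *\<^sub>R v) u) 0"
  shows "d sigma1 = 2 * (sigma2 x u * sigma3 x v - sigma3 x u * sigma2 x v)"
    and "d sigma2 = 2 * (sigma3 x u * sigma1 x v - sigma1 x u * sigma3 x v)"
    and "d sigma3 = 2 * (sigma1 x u * sigma2 x v - sigma2 x u * sigma1 x v)"
proof -
  let ?N = "(x$1)\<^sup>2 + (x$2)\<^sup>2 + (x$3)\<^sup>2 + (x$4)\<^sup>2"
  have N: "?N \<noteq> 0" using assms(1) norm4_sq[of x] by (metis norm_eq_zero zero_eq_power2)
  have frac: "a / ?N\<^sup>2 - b / ?N\<^sup>2 = 2 * ((- c / ?N) * (- e / ?N) - (- f / ?N) * (- g / ?N))"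
    if "a - b = 2 * (c * e - f * g)" for a b c e f g :: real
  proof -
    have "a / ?N\<^sup>2 - b / ?N\<^sup>2 = (2 * (c * e - f * g)) / ?N\<^sup>2"
      by (simp only: that[symmetric] diff_divide_distrib)
    then show ?thesis
      using N by (simp add: power2_eq_square diff_divide_distrib right_diff_distrib)
  qed
  have 1: "deriv (\<lambda>t. sigma1 (x + t *\<^sub>R w) z) 0 =
      (- (w$1 * z$2 - w$2 * z$1 - w$3 * z$4 + w$4 * z$3) * (norm x)\<^sup>2
       + 2 * (x$1 * z$2 - x$2 * z$1 - x$3 * z$4 + x$4 * z$3) * (x \<bullet> w)) / ((norm x)\<^sup>2)\<^sup>2" for w z
    unfolding sigma1_def
    by (rule DERIV_imp_deriv, rule sigma_deriv_aux[OF assms(1)]) (simp add: algebra_simps)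
  have 2: "deriv (\<lambda>t. sigma2 (x + t *\<^sub>R w) z) 0 =
      (- (w$1 * z$3 - w$3 * z$1 - w$4 * z$2 + w$2 * z$4) * (norm x)\<^sup>2
       + 2 * (x$1 * z$3 - x$3 * z$1 - x$4 * z$2 + x$2 * z$4) * (x \<bullet> w)) / ((norm x)\<^sup>2)\<^sup>2" for w z
    unfolding sigma2_def
    by (rule DERIV_imp_deriv, rule sigma_deriv_aux[OF assms(1)]) (simp add: algebra_simps)
  have 3: "deriv (\<lambda>t. sigma3 (x + t *\<^sub>R w) z) 0 =
      (- (w$1 * z$4 - w$4 * z$1 - w$2 * z$3 + w$3 * z$2) * (norm x)\<^sup>2
       + 2 * (x$1 * z$4 - x$4 * z$1 - x$2 * z$3 + x$3 * z$2) * (x \<bullet> w)) / ((norm x)\<^sup>2)\<^sup>2" for w z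
    unfolding sigma3_def
    by (rule DERIV_imp_deriv, rule sigma_deriv_aux[OF assms(1)]) (simp add: algebra_simps)
  show "d sigma1 = 2 * (sigma2 x u * sigma3 x v - sigma3 x u * sigma2 x v)"
    unfolding d_def 1 unfolding sigma2_def sigma3_def norm4_sq inner4
    by (rule frac) algebra
  show "d sigma2 = 2 * (sigma3 x u * sigma1 x v - sigma1 x u * sigma3 x v)"
    unfolding d_def 2 unfolding sigma3_def sigma1_def norm4_sq inner4
    by (rule frac) algebra
  show "d sigma3 = 2 * (sigma1 x u * sigma2 x v - sigma2 x u * sigma1 x v)"
    unfolding d_def 3 unfolding sigma1_def sigma2_def norm4_sq inner4
    by (rule frac) algebra
qed


section \<open>The Pedersen metric\<close>

text \<open>
  The parameter \<open>m2\<close> stands for \<open>m\<^sup>2\<close>, through which alone the metric depends on \<open>m\<close>. The squares of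
  \<open>1\<close>-forms are polarised, and the differential of \<open>\<rho> = \<bar>x\<bar>\<close> is \<open>u \<mapsto> (x \<bullet> u) / \<rho>\<close>. At the origin,
  where \<open>\<rho>\<close> and the \<open>\<sigma>\<^sub>i\<close> are singular, the smooth extension is the Euclidean inner product;
  see lemma \<open>pedersen_metric_smooth_form\<close>.
\<close>

definition pedersen_metric :: "real \<Rightarrow> 4 metric_field" where
  "pedersen_metric m2 x u v =
     (if x = 0 then u \<bullet> v
      else let \<rho> = norm x; d\<rho> = (\<lambda>w. (x \<bullet> w) / \<rho>) in
        1 / (1 - \<rho>^2)^2 *
        ((1 + m2 * \<rho>^2) / (1 + m2 * \<rho>^4) * (d\<rho> u * d\<rho> v)
         + \<rho>^2 * (1 + m2 * \<rho>^2) * (sigma1 x u * sigma1 x v + sigma2 x u * sigma2 x v)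
         + \<rho>^2 * (1 + m2 * \<rho>^4) / (1 + m2 * \<rho>^2) * (sigma3 x u * sigma3 x v)))"

text \<open>
  An expression for the metric that is smooth on the whole ball, including the origin.
\<close>

lemma pedersen_metric_smooth_form:
  fixes x u v :: "real ^ 4"
  assumes "m2 \<ge> 0"
  defines "s \<equiv> x \<bullet> x"
    and "\<theta> \<equiv> \<lambda>w :: real ^ 4. x$1 * w$4 - x$4 * w$1 - x$2 * w$3 + x$3 * w$2"
  shows "pedersen_metric m2 x u v =
     ((1 + m2 * s) * (u \<bullet> v)
      - m2 * s * (1 + m2 * s) / (1 + m2 * s\<^sup>2) * ((x \<bullet> u) * (x \<bullet> v))
      + m2 * (s - 2 - m2 * s) / (1 + m2 * s) * (\<theta> u * \<theta> v)) / (1 - s)\<^sup>2"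
proof (cases "x = 0")
  case True
  then show ?thesis by (simp add: pedersen_metric_def s_def \<theta>_def)
next
  case False
  then have s: "s > 0" by (simp add: s_def)
  have r2: "norm x ^ 2 = s" by (simp add: s_def power2_norm_eq_inner)
  have r4: "norm x ^ 4 = s\<^sup>2"
    using r2 by (metis mult_2_right numeral_Bit0 power_add power2_eq_square)
  have A: "1 + m2 * s > 0" and B: "1 + m2 * s\<^sup>2 > 0"
    using assms(1) s by (simp_all add: add_pos_nonneg)
  have s3: "sigma3 x u * sigma3 x v = \<theta> u * \<theta> v / s\<^sup>2"
    unfolding sigma3_def \<theta>_def r2
    by (simp only: minus_divide_left[symmetric] minus_mult_minus times_divide_times_eq
        power2_eq_square)
  have "s * (u \<bullet> v) = (x \<bullet> u) * (x \<bullet> v) + \<theta> u * \<theta> v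
      + (x$1 * u$2 - x$2 * u$1 - x$3 * u$4 + x$4 * u$3) * (x$1 * v$2 - x$2 * v$1 - x$3 * v$4 + x$4 * v$3)
      + (x$1 * u$3 - x$3 * u$1 - x$4 * u$2 + x$2 * u$4) * (x$1 * v$3 - x$3 * v$1 - x$4 * v$2 + x$2 * v$4)"
    unfolding s_def \<theta>_def inner4 by algebra
  then have s12: "sigma1 x u * sigma1 x v + sigma2 x u * sigma2 x v
      = (s * (u \<bullet> v) - (x \<bullet> u) * (x \<bullet> v) - \<theta> u * \<theta> v) / s\<^sup>2"
    unfolding sigma1_def sigma2_def r2
    by (simp only: minus_divide_left[symmetric] minus_mult_minus times_divide_times_eq
        power2_eq_square add_divide_distrib[symmetric]) simp
  have d: "(x \<bullet> u) / norm x * ((x \<bullet> v) / norm x) = (x \<bullet> u) * (x \<bullet> v) / s"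
    using r2 by (simp add: power2_eq_square)
  define a where "a = x \<bullet> u * (x \<bullet> v)"
  define c where "c = \<theta> u * \<theta> v"
  define e where "e = u \<bullet> v"
  have "(1 + m2 * s) / (1 + m2 * s\<^sup>2) * (a / s)
         + s * (1 + m2 * s) * ((s * e - a - c) / s\<^sup>2)
         + s * (1 + m2 * s\<^sup>2) / (1 + m2 * s) * (c / s\<^sup>2)
      = (1 + m2 * s) * e - m2 * s * (1 + m2 * s) / (1 + m2 * s\<^sup>2) * a
        + m2 * (s - 2 - m2 * s) / (1 + m2 * s) * c"
    using s A B by (simp add: divide_simps) algebra
  then show ?thesis
    using False
    unfolding pedersen_metric_def Let_def r2 r4 s12 s3 d a_def c_def e_def
    by (simp only: if_False mult_1_left times_divide_eq_left)
qed

end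

theory Submission
  imports Defs
begin

text \<open>
  Write \<open>s = \<bar>x\<bar>\<^sup>2\<close> and let \<open>J\<close> be the complex structure on \<open>\<real>\<^sup>4\<close> for which \<open>\<sigma>\<^sub>3\<close> is
  \<open>u \<mapsto> - (J x \<bullet> u) / s\<close>. The Pedersen metric then has the form
  \<open>A(s) u \<bullet> v + B(s) (x \<bullet> u) (x \<bullet> v) + C(s) (J x \<bullet> u) (J x \<bullet> v)\<close>, with rational \<open>A, B, C\<close>.
  It is Einstein, and one half of its Weyl tensor vanishes. By the unitary symmetry the other half
  has a double and a simple eigenvalue, and the simple one belongs to the fundamental form
  \<open>\<Omega>\<close> of an orthogonal almost complex structure \<open>I\<close>. For the plane spanned by \<open>u\<close> and \<open>v\<close>, with Gram
  determinant \<open>Q = g(u,u) g(v,v) - g(u,v)\<^sup>2\<close>, this amounts to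
  \<open>g(R(u,v)v, u) = - (4 + \<Lambda>/2) Q + 3/2 \<Lambda> \<Omega>(u,v)\<^sup>2\<close> with
  \<open>\<Lambda> = 4 m\<^sup>2 ((1 - s) / (1 + m\<^sup>2 s))\<^sup>3\<close>; see \<open>metric_riemann_pedersen\<close>.

  The theorem can be read off from this formula. Since \<open>\<Omega>(u,v) = g(I u, v)\<close> and \<open>I\<close> is orthogonal,
  \<open>0 \<le> \<Omega>(u,v)\<^sup>2 \<le> Q\<close>; the lower bound is attained on planes on which \<open>\<Omega>\<close> vanishes and the upper
  bound on the planes spanned by \<open>u\<close> and \<open>I u\<close>. Hence the least sectional curvature at \<open>x\<close> is
  \<open>- 4 - \<Lambda>/2 < 0\<close>, and the greatest one is \<open>\<Lambda> - 4\<close>. If \<open>m\<^sup>2 < 1\<close> then \<open>\<Lambda> < 4\<close> on the whole ball,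
  while at the origin \<open>\<Lambda> - 4\<close> is \<open>4 (m\<^sup>2 - 1)\<close>, which settles the cases \<open>m\<^sup>2 \<ge> 1\<close>,
  by continuity in a neighbourhood of the origin.

  The formula itself is a computation, organised so that Christoffel symbols never have to be listed.
  They are the components of any torsion-free metric connection (\<open>christoffel_eq\<close>), and
  the curvature can be expressed by the covectors \<open>w \<mapsto> g(\<Gamma>(u,v), w)\<close> and their derivatives alone
  (\<open>metric_riemann\<close>). For unknown functions \<open>A, B, C\<close> this gives \<open>g(R(u,v)v, u)\<close> as a
  combination of six quadratic expressions in \<open>u \<and> v\<close> (\<open>metric_riemann_eq\<close>). Inserting the Pedersen
  coefficients leaves six identities between rational functions of \<open>s\<close> and \<open>m\<^sup>2\<close>
  (\<open>pedersen_coefficients\<close>). They hold up to multiples of one linear relation between the six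
  expressions, the vanishing of the Hermitian Gram determinant of \<open>x, u, v\<close> in \<open>\<complex>\<^sup>2\<close>
  (\<open>gram_relation_4\<close>).
\<close>

section \<open>The Levi-Civita connection and its curvature\<close>

lemma pderiv_at_eq:
  assumes "(f has_derivative f') (at x)"
  shows "pderiv_at i f x = f' (axis i 1)"
proof -
  interpret bounded_linear f' using assms by (rule has_derivative_bounded_linear)
  have "((\<lambda>t::real. x + t *\<^sub>R axis i 1) has_derivative (\<lambda>t. t *\<^sub>R axis i 1)) (at 0)"
    by (auto intro!: derivative_eq_intros)
  moreover have "(f has_derivative f') (at (x + 0 *\<^sub>R axis i 1))" using assms by simp
  ultimately have "((\<lambda>t. f (x + t *\<^sub>R axis i 1)) has_derivative (\<lambda>t. f' (t *\<^sub>R axis i 1))) (at 0)"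
    by (rule has_derivative_compose)
  then have "((\<lambda>t. f (x + t *\<^sub>R axis i 1)) has_real_derivative f' (axis i 1)) (at 0)"
    by (simp add: has_field_derivative_def scaleR mult_commute_abs)
  then show ?thesis
    unfolding pderiv_at_def by (rule DERIV_imp_deriv)
qed

lemma linear_axis_sum:
  fixes f :: "real ^ 'n::finite \<Rightarrow> 'b::real_vector"
  assumes "linear f"
  shows "f w = (\<Sum>k\<in>UNIV. w $ k *\<^sub>R f (axis k 1))"
proof -
  have "f w = f (\<Sum>k\<in>UNIV. w $ k *\<^sub>R axis k 1)"
    by (metis basis_expansion scalar_mult_eq_scaleR)
  then show ?thesis using assms by (simp add: linear_sum linear_cmul)
qed

lemma gram_matrix_mult:
  assumes "bilinear (g x)"
  shows "(gram_matrix g x *v w) $ l = g x (axis l 1) w"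
proof -
  have "linear (g x (axis l 1))" using assms by (simp add: bilinear_def)
  from linear_axis_sum[OF this, of w] show ?thesis
    by (simp add: matrix_vector_mult_def gram_matrix_def mult.commute)
qed

text \<open>
  A metric \<open>g\<close> on an open set \<open>S\<close> together with a torsion-free metric connection
  \<open>\<nabla>\<^sub>u v = D\<^sub>u v + \<Gamma>(u,v)\<close>, without coordinates. Nondegeneracy is enough to make such a connection unique.
\<close>

locale levi_civita_on =
  fixes S :: "(real ^ 'n::finite) set" and g :: "'n metric_field"
    and \<Gamma> :: "real ^ 'n \<Rightarrow> real ^ 'n \<Rightarrow> real ^ 'n \<Rightarrow> real ^ 'n"
  assumes open_S: "open S"
    and bilinear_metric: "y \<in> S \<Longrightarrow> bilinear (g y)"
    and metric_sym: "y \<in> S \<Longrightarrow> g y u v = g y v u"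
    and nondegenerate: "y \<in> S \<Longrightarrow> (\<And>w. g y u w = 0) \<Longrightarrow> u = 0"
    and bilinear_conn: "y \<in> S \<Longrightarrow> bilinear (\<Gamma> y)"
    and torsion_free: "y \<in> S \<Longrightarrow> \<Gamma> y u v = \<Gamma> y v u"
    and metric_compatible: "y \<in> S \<Longrightarrow>
      ((\<lambda>z. g z v w) has_derivative (\<lambda>u. g y (\<Gamma> y u v) w + g y v (\<Gamma> y u w))) (at y)"
    and conn_differentiable: "y \<in> S \<Longrightarrow> (\<lambda>z. \<Gamma> z u v) differentiable (at y)"
begin

text \<open>
  Metric compatibility gives the partial derivatives of the metric coefficients in terms of \<open>\<Gamma>\<close>. In the
  alternating sum of the Christoffel formula all terms but \<open>2 g(\<Gamma>(\<partial>\<^sub>i,\<partial>\<^sub>j), \<partial>\<^sub>l)\<close> cancel by symmetry of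
  \<open>\<Gamma>\<close>, and the inverse Gram matrix raises the index.
\<close>

lemma christoffel_eq:
  assumes y: "y \<in> S"
  shows "christoffel g k i j y = \<Gamma> y (axis i 1) (axis j 1) $ k"
proof -
  let ?G = "gram_matrix g y" and ?w = "\<Gamma> y (axis i 1) (axis j 1)"
  have "w = 0" if "?G *v w = 0" for w
  proof (rule nondegenerate[OF y])
    fix z
    have "linear (\<lambda>z. g y z w)" using bilinear_metric[OF y] by (simp add: bilinear_def)
    moreover have "g y (axis l 1) w = 0" for l
      using that gram_matrix_mult[where g = g and x = y, OF bilinear_metric[OF y], of w l] by simp
    ultimately have "g y z w = 0" using linear_axis_sum[of "\<lambda>z. g y z w" z] by simp
    then show "g y w z = 0" using metric_sym[OF y] by simp
  qed
  then have "invertible ?G"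
    unfolding invertible_left_inverse matrix_left_invertible_ker by blast
  then have "matrix_inv ?G ** ?G = mat 1"
    unfolding invertible_def matrix_inv_def by (metis (mono_tags, lifting) someI_ex)
  then have inv: "matrix_inv ?G *v (?G *v ?w) = ?w"
    by (simp add: matrix_vector_mul_assoc)
  have lower: "(?G *v ?w) $ l = g y ?w (axis l 1)" for l
    using gram_matrix_mult[where g = g and x = y, OF bilinear_metric[OF y]] metric_sym[OF y] by simp
  have "(matrix_inv ?G *v z) $ k = (\<Sum>l\<in>UNIV. matrix_inv ?G $ k $ l * z $ l)" for z
    by (simp add: matrix_vector_mult_def)
  from this[of "?G *v ?w"] have raise: "?w $ k = (\<Sum>l\<in>UNIV. matrix_inv ?G $ k $ l * g y ?w (axis l 1))"
    unfolding inv lower .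
  have D: "pderiv_at i (\<lambda>z. gram_matrix g z $ j $ l) y
      = g y (\<Gamma> y (axis i 1) (axis j 1)) (axis l 1) + g y (axis j 1) (\<Gamma> y (axis i 1) (axis l 1))" for i j l
    unfolding gram_matrix_def using pderiv_at_eq[OF metric_compatible[OF y]] by simp
  have "pderiv_at i (\<lambda>z. gram_matrix g z $ j $ l) y
        + pderiv_at j (\<lambda>z. gram_matrix g z $ i $ l) y
        - pderiv_at l (\<lambda>z. gram_matrix g z $ i $ j) y = 2 * g y ?w (axis l 1)" for l
    unfolding D
    using torsion_free[OF y, of "axis j 1" "axis i 1"] torsion_free[OF y, of "axis l 1" "axis i 1"]
      torsion_free[OF y, of "axis l 1" "axis j 1"]
      metric_sym[OF y, of "axis j 1" "\<Gamma> y (axis i 1) (axis l 1)"]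
    by simp
  then show ?thesis
    unfolding christoffel_def raise by (simp add: sum_distrib_left algebra_simps)
qed

text \<open>
  The product rule \<open>u (g(X,w)) = g(\<nabla>\<^sub>u X, w) + g(X, \<nabla>\<^sub>u w)\<close> for a constant field \<open>w\<close>.
\<close>

lemma has_derivative_metric_vector_field:
  assumes x: "x \<in> S" and X: "(X has_derivative X') (at x)"
  shows "((\<lambda>y. g y (X y) w) has_derivative
    (\<lambda>u. g x (X' u + \<Gamma> x u (X x)) w + g x (X x) (\<Gamma> x u w))) (at x)"
proof -
  have expand: "g y z w = (\<Sum>k\<in>UNIV. z $ k * g y (axis k 1) w)" if "y \<in> S" for y z
    using linear_axis_sum[of "\<lambda>z. g y z w" z] bilinear_metric[OF that]
    by (simp add: bilinear_def)
  have lin: "linear (\<lambda>z. g x (\<Gamma> x u z) w + g x z (\<Gamma> x u w))" for u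
    using bilinear_metric[OF x] bilinear_conn[OF x]
    by (auto intro!: linearI simp: bilinear_ladd bilinear_radd bilinear_lmul bilinear_rmul
        algebra_simps)
  have comp: "((\<lambda>y. X y $ k) has_derivative (\<lambda>u. X' u $ k)) (at x)" for k
    using bounded_linear.has_derivative[OF bounded_linear_vec_nth X] .
  have "((\<lambda>y. \<Sum>k\<in>UNIV. X y $ k * g y (axis k 1) w) has_derivative
      (\<lambda>u. \<Sum>k\<in>UNIV. X x $ k * (g x (\<Gamma> x u (axis k 1)) w + g x (axis k 1) (\<Gamma> x u w))
          + X' u $ k * g x (axis k 1) w)) (at x)"
    by (intro has_derivative_sum has_derivative_mult comp metric_compatible[OF x])
  moreover have "(\<Sum>k\<in>UNIV. X x $ k * (g x (\<Gamma> x u (axis k 1)) w + g x (axis k 1) (\<Gamma> x u w))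
          + X' u $ k * g x (axis k 1) w)
      = g x (X' u + \<Gamma> x u (X x)) w + g x (X x) (\<Gamma> x u w)" for u
    using linear_axis_sum[OF lin, of u "X x"] expand[OF x, of "X' u"] bilinear_metric[OF x]
    by (simp add: sum.distrib bilinear_ladd)
  ultimately have "((\<lambda>y. \<Sum>k\<in>UNIV. X y $ k * g y (axis k 1) w) has_derivative
      (\<lambda>u. g x (X' u + \<Gamma> x u (X x)) w + g x (X x) (\<Gamma> x u w))) (at x)" by simp
  then show ?thesis
    by (rule has_derivative_transform_within_open[OF _ open_S x]) (simp add: expand[symmetric])
qed

definition conn_deriv :: "real ^ 'n \<Rightarrow> real ^ 'n \<Rightarrow> real ^ 'n \<Rightarrow> real ^ 'n \<Rightarrow> real ^ 'n" where
  "conn_deriv x u v w = frechet_derivative (\<lambda>y. \<Gamma> y v w) (at x) u"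

lemma has_derivative_conn:
  assumes "x \<in> S"
  shows "((\<lambda>y. \<Gamma> y v w) has_derivative (\<lambda>u. conn_deriv x u v w)) (at x)"
  unfolding conn_deriv_def using conn_differentiable[OF assms] frechet_derivative_works by blast

lemma conn_deriv_unique:
  assumes x: "x \<in> S" and "(F has_derivative F') (at x)" and "\<And>y. y \<in> S \<Longrightarrow> F y = \<Gamma> y v w"
  shows "conn_deriv x u v w = F' u"
proof -
  have "((\<lambda>y. \<Gamma> y v w) has_derivative F') (at x)"
    using assms(2) by (rule has_derivative_transform_within_open[OF _ open_S x]) (use assms(3) in auto)
  then show ?thesis using has_derivative_unique[OF has_derivative_conn[OF x]] by metis
qed

text \<open>
  Since \<open>\<Gamma>\<close> is bilinear at every point of \<open>S\<close>, its derivative inherits bilinearity from the uniqueness of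
  derivatives.
\<close>

lemma linear_conn_deriv:
  assumes x: "x \<in> S"
  shows "linear (\<lambda>u. conn_deriv x u v w)"
    and "linear (\<lambda>v. conn_deriv x u v w)"
    and "linear (\<lambda>w. conn_deriv x u v w)"
proof -
  show "linear (\<lambda>u. conn_deriv x u v w)"
    using has_derivative_conn[OF x] by (rule has_derivative_linear)
  show *: "linear (\<lambda>v. conn_deriv x u v w)" for w
  proof (rule linearI)
    fix v v' :: "real ^ 'n" and c :: real
    show "conn_deriv x u (v + v') w = conn_deriv x u v w + conn_deriv x u v' w"
      by (rule conn_deriv_unique[OF x has_derivative_add[OF has_derivative_conn[OF x] has_derivative_conn[OF x]]])
        (simp add: bilinear_ladd[OF bilinear_conn])
    show "conn_deriv x u (c *\<^sub>R v) w = c *\<^sub>R conn_deriv x u v w"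
      by (rule conn_deriv_unique[OF x has_derivative_scaleR_right[OF has_derivative_conn[OF x]]])
        (simp add: bilinear_lmul[OF bilinear_conn])
  qed
  have "conn_deriv x u v w = conn_deriv x u w v" for v w
    by (rule conn_deriv_unique[OF x has_derivative_conn[OF x] torsion_free])
  then show "linear (\<lambda>w. conn_deriv x u v w)" using *[of v] by simp
qed

lemma riemann_eq:
  assumes x: "x \<in> S"
  shows "riemann g x u v w =
    conn_deriv x u v w - conn_deriv x v u w + \<Gamma> x u (\<Gamma> x v w) - \<Gamma> x v (\<Gamma> x u w)"
proof -
  define R where "R u v w =
    conn_deriv x u v w - conn_deriv x v u w + \<Gamma> x u (\<Gamma> x v w) - \<Gamma> x v (\<Gamma> x u w)" for u v w
  have linear_conn: "linear (\<Gamma> x u)" "linear (\<lambda>u. \<Gamma> x u v)" for u v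
    using bilinear_conn[OF x] by (simp_all add: bilinear_def)
  note intros = linear_compose_add linear_compose_sub linear_conn_deriv[OF x] linear_conn
    linear_compose[OF linear_conn(2) linear_conn(1), unfolded o_def]
    linear_compose[OF linear_conn(1) linear_conn(1), unfolded o_def]
  have lin: "linear (\<lambda>u. R u v w)" "linear (\<lambda>v. R u v w)" "linear (\<lambda>w. R u v w)" for u v w
    unfolding R_def by (intro intros)+
  have coeff: "riemann_coeff g l i j k x = R (axis i 1) (axis j 1) (axis k 1) $ l" for i j k l
  proof -
    have D: "pderiv_at i (christoffel g l j k) x = conn_deriv x (axis i 1) (axis j 1) (axis k 1) $ l"
      for i j k
    proof (rule pderiv_at_eq)
      have "((\<lambda>y. \<Gamma> y (axis j 1) (axis k 1) $ l) has_derivative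
          (\<lambda>u. conn_deriv x u (axis j 1) (axis k 1) $ l)) (at x)"
        using bounded_linear.has_derivative[OF bounded_linear_vec_nth has_derivative_conn[OF x]] .
      then show "(christoffel g l j k has_derivative
          (\<lambda>u. conn_deriv x u (axis j 1) (axis k 1) $ l)) (at x)"
        by (rule has_derivative_transform_within_open[OF _ open_S x]) (simp add: christoffel_eq)
    qed
    have C: "(\<Sum>p\<in>UNIV. christoffel g l i p x * z $ p) = \<Gamma> x (axis i 1) z $ l" for i z
      using linear_axis_sum[OF linear_conn(1), of "axis i 1" z]
      by (simp add: christoffel_eq[OF x] mult.commute)
    show ?thesis
      unfolding riemann_coeff_def D sum_subtractf christoffel_eq[OF x, of _ j k] christoffel_eq[OF x, of _ i k] C
      by (simp add: R_def)
  qed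
  have "R u v w = (\<Sum>i\<in>UNIV. u $ i *\<^sub>R R (axis i 1) v w)"
    by (rule linear_axis_sum[OF lin(1)])
  also have "\<dots> = (\<Sum>i\<in>UNIV. u $ i *\<^sub>R (\<Sum>j\<in>UNIV. v $ j *\<^sub>R R (axis i 1) (axis j 1) w))"
    by (intro sum.cong refl arg_cong[where f = "scaleR _"] linear_axis_sum[OF lin(2)])
  also have "\<dots> = (\<Sum>i\<in>UNIV. u $ i *\<^sub>R (\<Sum>j\<in>UNIV. v $ j *\<^sub>R (\<Sum>k\<in>UNIV. w $ k *\<^sub>R
      R (axis i 1) (axis j 1) (axis k 1))))"
    by (intro sum.cong refl arg_cong[where f = "scaleR _"] linear_axis_sum[OF lin(3)])
  finally have "R u v w = riemann g x u v w"
    unfolding riemann_def coeff vec_eq_iff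
    by (simp add: sum_distrib_left mult_ac)
  then show ?thesis by (simp add: R_def)
qed

text \<open>
  In \<open>g(D\<^sub>u \<Gamma>(v,w) + \<Gamma>(u, \<Gamma>(v,w)), z)\<close> the derivative of \<open>\<Gamma>\<close> can be avoided: by the product rule this is the
  derivative of \<open>g(\<Gamma>(v,w), z)\<close> along \<open>u\<close>, minus \<open>g(\<Gamma>(v,w), \<Gamma>(u,z))\<close>. For metrics whose inverse is
  complicated, as below, the lowered expressions \<open>g(\<Gamma>(v,w), z)\<close> are much simpler than \<open>\<Gamma>\<close>.
\<close>

theorem metric_riemann:
  assumes x: "x \<in> S"
    and L: "((\<lambda>y. g y (\<Gamma> y v w) z) has_derivative L) (at x)"
    and M: "((\<lambda>y. g y (\<Gamma> y u w) z) has_derivative M) (at x)"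
  shows "g x (riemann g x u v w) z
    = L u - M v - g x (\<Gamma> x v w) (\<Gamma> x u z) + g x (\<Gamma> x u w) (\<Gamma> x v z)"
proof -
  have "L u = g x (conn_deriv x u v w + \<Gamma> x u (\<Gamma> x v w)) z + g x (\<Gamma> x v w) (\<Gamma> x u z)"
    using has_derivative_unique[OF L has_derivative_metric_vector_field[OF x has_derivative_conn[OF x]]]
    by metis
  moreover have "M v = g x (conn_deriv x v u w + \<Gamma> x v (\<Gamma> x u w)) z + g x (\<Gamma> x u w) (\<Gamma> x v z)"
    using has_derivative_unique[OF M has_derivative_metric_vector_field[OF x has_derivative_conn[OF x]]]
    by metis
  ultimately show ?thesis
    unfolding riemann_eq[OF x] using bilinear_metric[OF x]
    by (simp add: bilinear_ladd bilinear_lsub)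
qed

end

section \<open>Metrics on a complex vector space invariant under the unitary group\<close>

text \<open>
  The functions \<open>A, B, C\<close> of \<open>\<bar>y\<bar>\<^sup>2\<close> are the coefficients of the metric defined below; \<open>A1, A2\<close> etc. are their
  first and second derivatives. The last three assumptions say that the metric is nondegenerate:
  it acts on \<open>y\<close> as \<open>A + \<bar>y\<bar>\<^sup>2 B\<close>, on \<open>J y\<close> as \<open>A + \<bar>y\<bar>\<^sup>2 C\<close>, and on the orthogonal complement of both as \<open>A\<close>.
\<close>

locale unitary_metric =
  fixes J :: "real ^ 'n::finite \<Rightarrow> real ^ 'n" and S :: "(real ^ 'n) set"
    and A A1 A2 B B1 B2 C C1 C2 :: "real \<Rightarrow> real"
  assumes linear_J: "linear J"
    and J_square: "J (J u) = - u"
    and J_skew: "J u \<bullet> v = - (J v \<bullet> u)"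
    and open_S: "open S"
    and deriv_A: "y \<in> S \<Longrightarrow> (A has_real_derivative A1 (y \<bullet> y)) (at (y \<bullet> y))"
    and deriv_A1: "y \<in> S \<Longrightarrow> (A1 has_real_derivative A2 (y \<bullet> y)) (at (y \<bullet> y))"
    and deriv_B: "y \<in> S \<Longrightarrow> (B has_real_derivative B1 (y \<bullet> y)) (at (y \<bullet> y))"
    and deriv_B1: "y \<in> S \<Longrightarrow> (B1 has_real_derivative B2 (y \<bullet> y)) (at (y \<bullet> y))"
    and deriv_C: "y \<in> S \<Longrightarrow> (C has_real_derivative C1 (y \<bullet> y)) (at (y \<bullet> y))"
    and deriv_C1: "y \<in> S \<Longrightarrow> (C1 has_real_derivative C2 (y \<bullet> y)) (at (y \<bullet> y))"
    and A_nonzero: "y \<in> S \<Longrightarrow> A (y \<bullet> y) \<noteq> 0"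
    and radial_nonzero: "y \<in> S \<Longrightarrow> A (y \<bullet> y) + (y \<bullet> y) * B (y \<bullet> y) \<noteq> 0"
    and fibre_nonzero: "y \<in> S \<Longrightarrow> A (y \<bullet> y) + (y \<bullet> y) * C (y \<bullet> y) \<noteq> 0"
begin

definition metric :: "'n metric_field" where
  "metric y u v = A (y \<bullet> y) * (u \<bullet> v) + B (y \<bullet> y) * ((y \<bullet> u) * (y \<bullet> v))
     + C (y \<bullet> y) * ((J y \<bullet> u) * (J y \<bullet> v))"

text \<open>
  The inverse of the metric at \<open>y\<close>: a rank two correction of the Euclidean one; see \<open>metric_sharp\<close>.
\<close>

definition sharp :: "real ^ 'n \<Rightarrow> real ^ 'n \<Rightarrow> real ^ 'n" where
  "sharp y z = (1 / A (y \<bullet> y)) *\<^sub>R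
     (z - (B (y \<bullet> y) / (A (y \<bullet> y) + (y \<bullet> y) * B (y \<bullet> y)) * (y \<bullet> z)) *\<^sub>R y
        - (C (y \<bullet> y) / (A (y \<bullet> y) + (y \<bullet> y) * C (y \<bullet> y)) * (J y \<bullet> z)) *\<^sub>R J y)"

text \<open>
  The vector that represents the covector \<open>w \<mapsto> g(\<Gamma>(u,v), w)\<close> in the Euclidean inner product, computed
  from the Koszul formula \<open>2 g(\<Gamma>(u,v), w) = D\<^sub>u g(v,w) + D\<^sub>v g(u,w) - D\<^sub>w g(u,v)\<close>.
\<close>

definition lowered_conn :: "real ^ 'n \<Rightarrow> real ^ 'n \<Rightarrow> real ^ 'n \<Rightarrow> real ^ 'n" where
  "lowered_conn y u v =
     A1 (y \<bullet> y) *\<^sub>R ((y \<bullet> u) *\<^sub>R v + (y \<bullet> v) *\<^sub>R u)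
     + ((B (y \<bullet> y) - A1 (y \<bullet> y)) * (u \<bullet> v) + B1 (y \<bullet> y) * ((y \<bullet> u) * (y \<bullet> v))
          - C1 (y \<bullet> y) * ((J y \<bullet> u) * (J y \<bullet> v))) *\<^sub>R y
     + (C1 (y \<bullet> y) * ((y \<bullet> u) * (J y \<bullet> v) + (y \<bullet> v) * (J y \<bullet> u))) *\<^sub>R J y
     + C (y \<bullet> y) *\<^sub>R ((J y \<bullet> v) *\<^sub>R J u + (J y \<bullet> u) *\<^sub>R J v)"

definition conn :: "real ^ 'n \<Rightarrow> real ^ 'n \<Rightarrow> real ^ 'n \<Rightarrow> real ^ 'n" where
  "conn y u v = sharp y (lowered_conn y u v)"

lemma J_inner_self [simp]: "J u \<bullet> u = 0"
  using J_skew[of u u] by simp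

lemma J_isometry [simp]: "J u \<bullet> J v = u \<bullet> v"
  using J_skew[of u "J v"] by (simp add: J_square inner_commute)

lemma inner_J_self [simp]: "u \<bullet> J u = 0"
  using J_skew[of u u] by (simp add: inner_commute)

lemma inner_sharp:
  assumes "y \<in> S"
  shows "y \<bullet> sharp y z = (y \<bullet> z) / (A (y \<bullet> y) + (y \<bullet> y) * B (y \<bullet> y))"
    and "J y \<bullet> sharp y z = (J y \<bullet> z) / (A (y \<bullet> y) + (y \<bullet> y) * C (y \<bullet> y))"
proof -
  have "1 / a * (t - b / (a + r * b) * t * r) = t / (a + r * b)"
    if "a \<noteq> 0" "a + r * b \<noteq> 0" for a b r t :: real
    using that by (simp add: field_simps)
  from this[OF A_nonzero[OF assms] radial_nonzero[OF assms], of "y \<bullet> z"]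
    this[OF A_nonzero[OF assms] fibre_nonzero[OF assms], of "J y \<bullet> z"]
  show "y \<bullet> sharp y z = (y \<bullet> z) / (A (y \<bullet> y) + (y \<bullet> y) * B (y \<bullet> y))"
    and "J y \<bullet> sharp y z = (J y \<bullet> z) / (A (y \<bullet> y) + (y \<bullet> y) * C (y \<bullet> y))"
    by (simp_all add: sharp_def inner_diff_right)
qed

lemma metric_sharp:
  assumes "y \<in> S"
  shows "metric y (sharp y z) w = z \<bullet> w"
proof -
  have "A (y \<bullet> y) * (sharp y z \<bullet> w) = z \<bullet> w
      - B (y \<bullet> y) / (A (y \<bullet> y) + (y \<bullet> y) * B (y \<bullet> y)) * (y \<bullet> z) * (y \<bullet> w)
      - C (y \<bullet> y) / (A (y \<bullet> y) + (y \<bullet> y) * C (y \<bullet> y)) * (J y \<bullet> z) * (J y \<bullet> w)"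
    using A_nonzero[OF assms] by (simp add: sharp_def inner_diff_left)
  then show ?thesis
    unfolding metric_def inner_sharp[OF assms] by simp
qed

lemma bounded_linear_J: "bounded_linear J"
  using linear_J by (simp add: linear_conv_bounded_linear)

lemmas has_derivative_J [derivative_intros] = bounded_linear.has_derivative[OF bounded_linear_J]

lemma has_derivative_radial:
  assumes "(f has_real_derivative D) (at (x \<bullet> x))"
  shows "((\<lambda>y. f (y \<bullet> y)) has_derivative (\<lambda>u. 2 * D * (x \<bullet> u))) (at x)"
proof -
  have "((\<lambda>y. y \<bullet> y) has_derivative (\<lambda>u. 2 * (x \<bullet> u))) (at x)"
    by (auto intro!: derivative_eq_intros simp: inner_commute)
  from DERIV_compose_FDERIV[OF assms this] show ?thesis by (simp add: mult_ac)
qed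

lemma metric_conn: "y \<in> S \<Longrightarrow> metric y (conn y u v) w = lowered_conn y u v \<bullet> w"
  by (simp add: conn_def metric_sharp)

lemma metric_commute: "metric y u v = metric y v u"
  by (simp add: metric_def inner_commute mult.commute)

lemma has_derivative_metric:
  assumes "y \<in> S"
  shows "((\<lambda>z. metric z v w) has_derivative
     (\<lambda>u. metric y (conn y u v) w + metric y v (conn y u w))) (at y)"
proof -
  have "((\<lambda>z. metric z v w) has_derivative (\<lambda>u.
      2 * A1 (y \<bullet> y) * (y \<bullet> u) * (v \<bullet> w)
      + (2 * B1 (y \<bullet> y) * (y \<bullet> u) * ((y \<bullet> v) * (y \<bullet> w))
         + B (y \<bullet> y) * ((u \<bullet> v) * (y \<bullet> w) + (y \<bullet> v) * (u \<bullet> w)))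
      + (2 * C1 (y \<bullet> y) * (y \<bullet> u) * ((J y \<bullet> v) * (J y \<bullet> w))
         + C (y \<bullet> y) * ((J u \<bullet> v) * (J y \<bullet> w) + (J y \<bullet> v) * (J u \<bullet> w))))) (at y)"
    unfolding metric_def
    by (auto intro!: derivative_eq_intros has_derivative_radial deriv_A[OF assms] deriv_B[OF assms]
        deriv_C[OF assms] simp: fun_eq_iff algebra_simps)
  moreover have "lowered_conn y u v \<bullet> w + lowered_conn y u w \<bullet> v =
      2 * A1 (y \<bullet> y) * (y \<bullet> u) * (v \<bullet> w)
      + (2 * B1 (y \<bullet> y) * (y \<bullet> u) * ((y \<bullet> v) * (y \<bullet> w))
         + B (y \<bullet> y) * ((u \<bullet> v) * (y \<bullet> w) + (y \<bullet> v) * (u \<bullet> w)))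
      + (2 * C1 (y \<bullet> y) * (y \<bullet> u) * ((J y \<bullet> v) * (J y \<bullet> w))
         + C (y \<bullet> y) * ((J u \<bullet> v) * (J y \<bullet> w) + (J y \<bullet> v) * (J u \<bullet> w)))" for u
    using J_skew[of w v] by (simp add: lowered_conn_def inner_add_left inner_commute algebra_simps)
  moreover have "metric y (conn y u v) w + metric y v (conn y u w) =
     lowered_conn y u v \<bullet> w + lowered_conn y u w \<bullet> v" for u
    by (simp add: metric_conn[OF assms] metric_commute[of y v])
  ultimately show ?thesis by simp
qed

lemma differentiable_conn:
  assumes "x \<in> S"
  shows "(\<lambda>y. conn y u v) differentiable (at x)"
proof -
  have f: "(\<lambda>y. f (y \<bullet> y)) differentiable (at x)" if "(f has_real_derivative D) (at (x \<bullet> x))" for f D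
    using has_derivative_radial[OF that] by (rule differentiableI)
  have J: "J differentiable (at x)"
    using has_derivative_J[OF has_derivative_ident] by (rule differentiableI)
  have lowered: "(\<lambda>y. lowered_conn y u v) differentiable (at x)"
    unfolding lowered_conn_def
    by (intro differentiable_add differentiable_scaleR differentiable_diff differentiable_mult
      differentiable_const differentiable_inner differentiable_ident J
      f[OF deriv_A1[OF assms]] f[OF deriv_B[OF assms]] f[OF deriv_B1[OF assms]]
      f[OF deriv_C[OF assms]] f[OF deriv_C1[OF assms]])
  show ?thesis
    unfolding conn_def sharp_def using assms
    by (intro differentiable_add differentiable_scaleR differentiable_diff differentiable_mult
      differentiable_divide differentiable_const differentiable_inner differentiable_ident J lowered
      f[OF deriv_A[OF assms]] f[OF deriv_B[OF assms]] f[OF deriv_C[OF assms]]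
      A_nonzero radial_nonzero fibre_nonzero)
qed

sublocale levi_civita_on S metric conn
proof
  fix y u v w assume y: "y \<in> S"
  have J: "J (a + b) = J a + J b" "J (c *\<^sub>R a) = c *\<^sub>R J a" for a b c
    using linear_J by (simp_all add: linear_add linear_cmul)
  show "bilinear (metric y)"
    unfolding bilinear_def metric_def
    by (auto intro!: linearI simp: inner_add_left inner_add_right algebra_simps)
  have "lowered_conn y u v = lowered_conn y v u" for u v
    unfolding lowered_conn_def by (simp add: inner_commute add_ac mult_ac)
  then show sym: "conn y u v = conn y v u" for u v
    unfolding conn_def by simp
  have "linear (\<lambda>u. lowered_conn y u v)" for v
  proof (rule linearI; subst vector_eq_rdot[symmetric], intro allI)
    fix a b z :: "real ^ 'n" and c :: real
    show "lowered_conn y (a + b) v \<bullet> z = (lowered_conn y a v + lowered_conn y b v) \<bullet> z"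
      by (simp add: lowered_conn_def inner_add_left inner_add_right J algebra_simps)
    show "lowered_conn y (c *\<^sub>R a) v \<bullet> z = (c *\<^sub>R lowered_conn y a v) \<bullet> z"
      by (simp add: lowered_conn_def inner_add_left inner_add_right J algebra_simps)
  qed
  moreover have "linear (sharp y)"
  proof (rule linearI; subst vector_eq_rdot[symmetric], intro allI)
    fix a b z :: "real ^ 'n" and c :: real
    show "sharp y (a + b) \<bullet> z = (sharp y a + sharp y b) \<bullet> z"
      by (simp add: sharp_def inner_add_left inner_add_right inner_diff_left ring_distribs add_divide_distrib)
    show "sharp y (c *\<^sub>R a) \<bullet> z = (c *\<^sub>R sharp y a) \<bullet> z"
      by (simp add: sharp_def inner_add_left inner_add_right inner_diff_left algebra_simps)
  qed
  ultimately have "linear (\<lambda>u. conn y u v)" for v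
    unfolding conn_def using linear_compose[of "\<lambda>u. lowered_conn y u v" "sharp y"] by (simp add: o_def)
  moreover from this have "linear (\<lambda>v. conn y u v)" for u
    using sym[of u] by simp
  ultimately show "bilinear (conn y)"
    unfolding bilinear_def by blast
  show "u = 0" if "\<And>w. metric y u w = 0"
    using that[of "sharp y u"] metric_sharp[OF y, of u u] metric_commute[of y u] by simp
qed (auto intro: open_S metric_commute has_derivative_metric differentiable_conn)

lemma inner_lowered_conn:
  "lowered_conn y u v \<bullet> w =
     A1 (y \<bullet> y) * ((y \<bullet> u) * (v \<bullet> w) + (y \<bullet> v) * (u \<bullet> w))
     + ((B (y \<bullet> y) - A1 (y \<bullet> y)) * (u \<bullet> v) + B1 (y \<bullet> y) * ((y \<bullet> u) * (y \<bullet> v))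
          - C1 (y \<bullet> y) * ((J y \<bullet> u) * (J y \<bullet> v))) * (y \<bullet> w)
     + C1 (y \<bullet> y) * ((y \<bullet> u) * (J y \<bullet> v) + (y \<bullet> v) * (J y \<bullet> u)) * (J y \<bullet> w)
     + C (y \<bullet> y) * ((J y \<bullet> v) * (J u \<bullet> w) + (J y \<bullet> u) * (J v \<bullet> w))"
  by (simp add: lowered_conn_def inner_add_left)

text \<open>
  The sectional curvature form depends on \<open>u \<and> v\<close> only. With \<open>p = x \<bullet> u\<close>, \<open>q = x \<bullet> v\<close>, \<open>\<theta> = J x \<bullet> u\<close>,
  \<open>\<phi> = J x \<bullet> v\<close>, the invariants of this bivector are its squared norm, the squared norms of its contractions
  \<open>p v - q u\<close> and \<open>\<theta> v - \<phi> u\<close> with \<open>x\<close> and \<open>J x\<close>, and the numbers \<open>p \<phi> - q \<theta>\<close> and \<open>\<omega> = J u \<bullet> v\<close>. In each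
  coefficient the part outside the fraction comes from the derivatives of the lowered connection, the
  fraction from the quadratic terms \<open>g(\<Gamma>(u,v), \<Gamma>(u,v)) - g(\<Gamma>(u,u), \<Gamma>(v,v))\<close>; the constants \<open>kb\<close> and \<open>kc\<close>
  carry the corrections of the inverse metric in the directions \<open>x\<close> and \<open>J x\<close>.
\<close>

theorem metric_riemann_eq:
  fixes x u v :: "real ^ 'n"
  assumes x: "x \<in> S"
  defines "s \<equiv> x \<bullet> x" and "p \<equiv> x \<bullet> u" and "q \<equiv> x \<bullet> v" and "\<theta> \<equiv> J x \<bullet> u" and "\<phi> \<equiv> J x \<bullet> v"
    and "\<omega> \<equiv> J u \<bullet> v"
  defines "a \<equiv> A s" and "a1 \<equiv> A1 s" and "a2 \<equiv> A2 s" and "b \<equiv> B s" and "b1 \<equiv> B1 s"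
    and "c \<equiv> C s" and "c1 \<equiv> C1 s" and "c2 \<equiv> C2 s"
  defines "k1 \<equiv> s * (b - a1)" and "k2 \<equiv> 2 * a1 + s * b1" and "k3 \<equiv> - (2 * c + s * c1)"
    and "l \<equiv> a1 + c + s * c1"
    and "kb \<equiv> b / (a + s * b)" and "kc \<equiv> c / (a + s * c)"
  shows "metric x (riemann metric x u v v) u =
    (b - 2 * a1 + (kb * k1\<^sup>2 - s * (b - a1)\<^sup>2) / a) * ((u \<bullet> u) * (v \<bullet> v) - (u \<bullet> v)\<^sup>2)
    + (b1 - 2 * a2 + (a1\<^sup>2 - 2 * a1 * (b - a1) - s * (b - a1) * b1 + kb * k1 * k2) / a)
        * (p\<^sup>2 * (v \<bullet> v) - 2 * p * q * (u \<bullet> v) + q\<^sup>2 * (u \<bullet> u))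
    + (- c1 + (s * (b - a1) * c1 + 2 * c * (b - a1) + c\<^sup>2 + kb * k1 * k3) / a)
        * (\<theta>\<^sup>2 * (v \<bullet> v) - 2 * \<theta> * \<phi> * (u \<bullet> v) + \<phi>\<^sup>2 * (u \<bullet> u))
    + (- 2 * c2 + (4 * a1 * c1 + s * b1 * c1 + 2 * b1 * c + s * c1\<^sup>2 + 2 * c * c1
          + kb * k2 * k3 - kc * l\<^sup>2) / a) * (p * \<phi> - q * \<theta>)\<^sup>2
    + (- 6 * c1 + 6 * a1 * c / a) * (\<omega> * (p * \<phi> - q * \<theta>))
    - 3 * c * \<omega>\<^sup>2"
proof -
  define U V h where "U = u \<bullet> u" and "V = v \<bullet> v" and "h = u \<bullet> v"
  note folds = s_def[symmetric] p_def[symmetric] q_def[symmetric] \<theta>_def[symmetric] \<phi>_def[symmetric]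
    \<omega>_def[symmetric] U_def[symmetric] V_def[symmetric] h_def[symmetric]
    a_def[symmetric] a1_def[symmetric] a2_def[symmetric] b_def[symmetric] b1_def[symmetric]
    c_def[symmetric] c1_def[symmetric] c2_def[symmetric]
  have swap: "v \<bullet> u = h" "u \<bullet> x = p" "v \<bullet> x = q" "u \<bullet> J x = \<theta>" "v \<bullet> J x = \<phi>" "v \<bullet> J u = \<omega>"
    "J v \<bullet> u = - \<omega>" "u \<bullet> J v = - \<omega>" "J u \<bullet> x = - \<theta>" "J v \<bullet> x = - \<phi>"
    "x \<bullet> J u = - \<theta>" "x \<bullet> J v = - \<phi>"
    using J_skew[of u v] J_skew[of u x] J_skew[of v x]
    by (simp_all add: p_def q_def \<theta>_def \<phi>_def \<omega>_def h_def inner_commute)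
  \<comment> \<open>\<open>L\<close> and \<open>M\<close> are the differentials at \<open>x\<close> of \<open>g(\<Gamma>(v,v), u)\<close> and \<open>g(\<Gamma>(u,v), u)\<close>.\<close>
  define L where "L z = 2 * (x \<bullet> z) * (2 * a2 * q * h + (b1 - a2) * V * p + B2 s * q * q * p
        - c2 * \<phi> * \<phi> * p + 2 * c2 * q * \<phi> * \<theta> - 2 * c1 * \<phi> * \<omega>)
      + 2 * a1 * (z \<bullet> v) * h + (b - a1) * V * (z \<bullet> u) + b1 * (2 * q * (z \<bullet> v) * p + q * q * (z \<bullet> u))
      - c1 * (2 * \<phi> * (J z \<bullet> v) * p + \<phi> * \<phi> * (z \<bullet> u))
      + 2 * c1 * ((z \<bullet> v) * \<phi> * \<theta> + q * (J z \<bullet> v) * \<theta> + q * \<phi> * (J z \<bullet> u)) - 2 * c * (J z \<bullet> v) * \<omega>" for z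
  define M where "M z = 2 * (x \<bullet> z) * (a2 * q * U + b1 * h * p + B2 s * p * p * q
        + c2 * q * \<theta> * \<theta> - c1 * \<theta> * \<omega>)
      + a1 * (z \<bullet> v) * U + b * h * (z \<bullet> u) + b1 * (2 * p * (z \<bullet> u) * q + p * p * (z \<bullet> v))
      + c1 * ((z \<bullet> v) * \<theta> * \<theta> + 2 * q * \<theta> * (J z \<bullet> u)) - c * (J z \<bullet> u) * \<omega>" for z
  note derivs = has_derivative_radial[OF deriv_A1[OF x]] has_derivative_radial[OF deriv_B[OF x]]
    has_derivative_radial[OF deriv_B1[OF x]] has_derivative_radial[OF deriv_C[OF x]]
    has_derivative_radial[OF deriv_C1[OF x]]
  have "((\<lambda>y. 2 * A1 (y \<bullet> y) * (y \<bullet> v) * h + (B (y \<bullet> y) - A1 (y \<bullet> y)) * V * (y \<bullet> u)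
        + B1 (y \<bullet> y) * ((y \<bullet> v) * (y \<bullet> v) * (y \<bullet> u)) - C1 (y \<bullet> y) * ((J y \<bullet> v) * (J y \<bullet> v) * (y \<bullet> u))
        + 2 * C1 (y \<bullet> y) * ((y \<bullet> v) * (J y \<bullet> v) * (J y \<bullet> u)) - 2 * C (y \<bullet> y) * (J y \<bullet> v) * \<omega>)
      has_derivative L) (at x)"
    by (auto intro!: derivative_eq_intros derivs simp: L_def fun_eq_iff folds algebra_simps)
  then have L: "((\<lambda>y. metric y (conn y v v) u) has_derivative L) (at x)"
    by (rule has_derivative_transform_within_open[OF _ open_S x])
      (simp add: metric_conn inner_lowered_conn swap folds algebra_simps)
  have "((\<lambda>y. A1 (y \<bullet> y) * (y \<bullet> v) * U + B (y \<bullet> y) * (h * (y \<bullet> u))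
        + B1 (y \<bullet> y) * ((y \<bullet> u) * (y \<bullet> u) * (y \<bullet> v)) + C1 (y \<bullet> y) * ((y \<bullet> v) * (J y \<bullet> u) * (J y \<bullet> u))
        - C (y \<bullet> y) * (J y \<bullet> u) * \<omega>) has_derivative M) (at x)"
    by (auto intro!: derivative_eq_intros derivs simp: M_def fun_eq_iff folds algebra_simps)
  then have M: "((\<lambda>y. metric y (conn y u v) u) has_derivative M) (at x)"
    by (rule has_derivative_transform_within_open[OF _ open_S x])
      (simp add: metric_conn inner_lowered_conn swap folds algebra_simps)
  let ?uu = "lowered_conn x u u" and ?uv = "lowered_conn x u v" and ?vv = "lowered_conn x v v"
  have radial: "x \<bullet> ?uu = k1 * U + k2 * p\<^sup>2 + k3 * \<theta>\<^sup>2" "x \<bullet> ?uv = k1 * h + k2 * p * q + k3 * \<theta> * \<phi>"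
      "x \<bullet> ?vv = k1 * V + k2 * q\<^sup>2 + k3 * \<phi>\<^sup>2"
    by (simp_all add: inner_lowered_conn[THEN trans[OF inner_commute]] swap folds k1_def k2_def k3_def algebra_simps
        power2_eq_square)
  have fibre: "J x \<bullet> ?uu = 2 * l * p * \<theta>" "J x \<bullet> ?uv = l * (p * \<phi> + q * \<theta>)" "J x \<bullet> ?vv = 2 * l * q * \<phi>"
    by (simp_all add: inner_lowered_conn[THEN trans[OF inner_commute]] swap folds l_def algebra_simps)
  have sharp: "y \<bullet> sharp x z = (y \<bullet> z - kb * (x \<bullet> y) * (x \<bullet> z) - kc * (J x \<bullet> y) * (J x \<bullet> z)) / a" for y z
    using inner_commute[of y x] inner_commute[of y "J x"]
    by (simp add: sharp_def inner_diff_right folds kb_def kc_def mult_ac)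
  have uv: "?uv \<bullet> ?uv - ?vv \<bullet> ?uu = - s * (b - a1)\<^sup>2 * (U * V - h\<^sup>2)
      + (a1\<^sup>2 - 2 * a1 * (b - a1) - s * (b - a1) * b1) * (p\<^sup>2 * V - 2 * p * q * h + q\<^sup>2 * U)
      + (s * (b - a1) * c1 + 2 * c * (b - a1) + c\<^sup>2) * (\<theta>\<^sup>2 * V - 2 * \<theta> * \<phi> * h + \<phi>\<^sup>2 * U)
      + (4 * a1 * c1 + s * b1 * c1 + 2 * b1 * c + s * c1\<^sup>2 + 2 * c * c1) * (p * \<phi> - q * \<theta>)\<^sup>2
      + 6 * a1 * c * \<omega> * (p * \<phi> - q * \<theta>)"
    unfolding inner_lowered_conn inner_lowered_conn[THEN trans[OF inner_commute]] swap folds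
      J_isometry J_inner_self inner_J_self by algebra
  have LM: "L u - M v = (b - 2 * a1) * (U * V - h\<^sup>2)
      + (b1 - 2 * a2) * (p\<^sup>2 * V - 2 * p * q * h + q\<^sup>2 * U) - c1 * (\<theta>\<^sup>2 * V - 2 * \<theta> * \<phi> * h + \<phi>\<^sup>2 * U)
      - 2 * c2 * (p * \<phi> - q * \<theta>)\<^sup>2 - 6 * c1 * (\<omega> * (p * \<phi> - q * \<theta>)) - 3 * c * \<omega>\<^sup>2"
    by (simp add: L_def M_def swap folds power2_eq_square algebra_simps)
  have "metric x (riemann metric x u v v) u = L u - M v
      - metric x (conn x v v) (conn x u u) + metric x (conn x u v) (conn x v u)"
    by (rule metric_riemann[OF x L M])
  also have "\<dots> = L u - M v + (?uv \<bullet> ?uv - ?vv \<bullet> ?uu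
      + kb * ((x \<bullet> ?uu) * (x \<bullet> ?vv) - (x \<bullet> ?uv)\<^sup>2)
      + kc * ((J x \<bullet> ?uu) * (J x \<bullet> ?vv) - (J x \<bullet> ?uv)\<^sup>2)) / a"
    unfolding torsion_free[OF x, of v u] metric_conn[OF x]
    unfolding conn_def sharp by (simp add: add_divide_distrib diff_divide_distrib power2_eq_square algebra_simps)
  finally have eq: "metric x (riemann metric x u v v) u = L u - M v + (?uv \<bullet> ?uv - ?vv \<bullet> ?uu
      + kb * ((x \<bullet> ?uu) * (x \<bullet> ?vv) - (x \<bullet> ?uv)\<^sup>2)
      + kc * ((J x \<bullet> ?uu) * (J x \<bullet> ?vv) - (J x \<bullet> ?uv)\<^sup>2)) / a" .
  show ?thesis
    unfolding eq LM uv radial fibre folds divide_inverse by algebra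
qed

end

section \<open>The Pedersen metric as a unitarily invariant metric\<close>

text \<open>
  Right multiplication by the quaternion \<open>k\<close>. It commutes with the left multiplications, and \<open>J x\<close> is tangent
  to the Hopf circle through \<open>x\<close>, the direction that \<open>\<sigma>\<^sub>3\<close> measures.
\<close>

definition hopf_J :: "real ^ 4 \<Rightarrow> real ^ 4" where
  "hopf_J x = vector [- x$4, x$3, - x$2, x$1]"

lemma hopf_J_nth [simp]:
  "hopf_J x $ 1 = - x$4" "hopf_J x $ 2 = x$3" "hopf_J x $ 3 = - x$2" "hopf_J x $ 4 = x$1"
  by (simp_all add: hopf_J_def vector_def)

text \<open>
  The coefficients in \<open>pedersen_metric_smooth_form\<close>. The derivatives are written over
  common denominators, in the shape in which the curvature identities use them.
\<close>

definition pedersen_A :: "real \<Rightarrow> real \<Rightarrow> real" where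
  "pedersen_A m s = (1 + m * s) / (1 - s)\<^sup>2"

definition pedersen_A1 :: "real \<Rightarrow> real \<Rightarrow> real" where
  "pedersen_A1 m s = (m + 2 + m * s) / (1 - s) ^ 3"

definition pedersen_A2 :: "real \<Rightarrow> real \<Rightarrow> real" where
  "pedersen_A2 m s = (4 * m + 6 + 2 * m * s) / (1 - s) ^ 4"

definition pedersen_B :: "real \<Rightarrow> real \<Rightarrow> real" where
  "pedersen_B m s = - m * s * (1 + m * s) / ((1 + m * s\<^sup>2) * (1 - s)\<^sup>2)"

definition pedersen_B1 :: "real \<Rightarrow> real \<Rightarrow> real" where
  "pedersen_B1 m s = - m * ((1 + 2 * m * s) * (1 + m * s\<^sup>2) * (1 - s)
     - 2 * m * s\<^sup>2 * (1 + m * s) * (1 - s) + 2 * s * (1 + m * s) * (1 + m * s\<^sup>2))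
     / ((1 + m * s\<^sup>2)\<^sup>2 * (1 - s) ^ 3)"

definition pedersen_C :: "real \<Rightarrow> real \<Rightarrow> real" where
  "pedersen_C m s = m * (s - 2 - m * s) / ((1 + m * s) * (1 - s)\<^sup>2)"

definition pedersen_C1 :: "real \<Rightarrow> real \<Rightarrow> real" where
  "pedersen_C1 m s = m * ((1 - m) * (1 + m * s) * (1 - s) - m * (s - 2 - m * s) * (1 - s)
     + 2 * (s - 2 - m * s) * (1 + m * s)) / ((1 + m * s)\<^sup>2 * (1 - s) ^ 3)"

definition pedersen_C2 :: "real \<Rightarrow> real \<Rightarrow> real" where
  "pedersen_C2 m s = m * (- 2 * m * (1 - m) * (1 + m * s) * (1 - s)\<^sup>2
     + 4 * (1 - m) * (1 + m * s)\<^sup>2 * (1 - s) + 2 * m\<^sup>2 * (s - 2 - m * s) * (1 - s)\<^sup>2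
     - 4 * m * (s - 2 - m * s) * (1 + m * s) * (1 - s) + 6 * (s - 2 - m * s) * (1 + m * s)\<^sup>2)
     / ((1 + m * s) ^ 3 * (1 - s) ^ 4)"

text \<open>
  Cross-multiplication turns the derivative of a quotient into a polynomial identity for the claimed
  numerator \<open>N\<close> and denominator \<open>k\<close>.
\<close>

lemma DERIV_quotient_eq:
  assumes "(f has_real_derivative f') (at s)" "(g has_real_derivative g') (at s)" "g s \<noteq> 0"
    and "(f' * g s - f s * g') * k = N * (g s)\<^sup>2" and "k \<noteq> 0"
  shows "((\<lambda>s. f s / g s) has_real_derivative N / k) (at (s::real))"
proof -
  have "(f' * g s - f s * g') / (g s * g s) = N / k"
    using assms(3-5) by (simp add: frac_eq_eq power2_eq_square)
  with DERIV_divide[OF assms(1-3)] show ?thesis by simp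
qed

lemma pedersen_derivatives:
  assumes nz: "1 + m * s \<noteq> 0" "1 + m * s\<^sup>2 \<noteq> 0" "1 - s \<noteq> 0"
  shows "(pedersen_A m has_real_derivative pedersen_A1 m s) (at s)"
    and "(pedersen_A1 m has_real_derivative pedersen_A2 m s) (at s)"
    and "(pedersen_B m has_real_derivative pedersen_B1 m s) (at s)"
    and "(pedersen_B1 m has_real_derivative deriv (pedersen_B1 m) s) (at s)"
    and "(pedersen_C m has_real_derivative pedersen_C1 m s) (at s)"
    and "(pedersen_C1 m has_real_derivative pedersen_C2 m s) (at s)"
proof -
  show "(pedersen_A m has_real_derivative pedersen_A1 m s) (at s)"
    unfolding pedersen_A_def[abs_def] pedersen_A1_def
  proof (rule DERIV_quotient_eq)
    show "((\<lambda>s. (1 + m * s)) has_real_derivative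
        m) (at s)"
      by (auto intro!: derivative_eq_intros simp: algebra_simps)
    show "((\<lambda>s. (1 - s)\<^sup>2) has_real_derivative
        - 2 * (1 - s)) (at s)"
      by (auto intro!: derivative_eq_intros simp: algebra_simps power2_eq_square)
  qed ((use nz in simp; fail) | algebra)+
  show "(pedersen_A1 m has_real_derivative pedersen_A2 m s) (at s)"
    unfolding pedersen_A1_def[abs_def] pedersen_A2_def
  proof (rule DERIV_quotient_eq)
    show "((\<lambda>s. m + 2 + m * s) has_real_derivative
        m) (at s)"
      by (auto intro!: derivative_eq_intros simp: algebra_simps)
    show "((\<lambda>s. (1 - s) ^ 3) has_real_derivative
        - 3 * (1 - s)\<^sup>2) (at s)"
      by (auto intro!: derivative_eq_intros simp: algebra_simps power2_eq_square)
  qed ((use nz in simp; fail) | algebra)+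
  show "(pedersen_B m has_real_derivative pedersen_B1 m s) (at s)"
    unfolding pedersen_B_def[abs_def] pedersen_B1_def
  proof (rule DERIV_quotient_eq)
    show "((\<lambda>s. - m * s * (1 + m * s)) has_real_derivative
        - m * (1 + 2 * m * s)) (at s)"
      by (auto intro!: derivative_eq_intros simp: algebra_simps)
    show "((\<lambda>s. (1 + m * s\<^sup>2) * (1 - s)\<^sup>2) has_real_derivative
        2 * m * s * (1 - s)\<^sup>2 - 2 * (1 + m * s\<^sup>2) * (1 - s)) (at s)"
      by (auto intro!: derivative_eq_intros simp: algebra_simps power2_eq_square)
  qed ((use nz in simp; fail) | algebra)+
  show "(pedersen_C m has_real_derivative pedersen_C1 m s) (at s)"
    unfolding pedersen_C_def[abs_def] pedersen_C1_def
  proof (rule DERIV_quotient_eq)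
    show "((\<lambda>s. m * (s - 2 - m * s)) has_real_derivative
        m * (1 - m)) (at s)"
      by (auto intro!: derivative_eq_intros simp: algebra_simps)
    show "((\<lambda>s. (1 + m * s) * (1 - s)\<^sup>2) has_real_derivative
        m * (1 - s)\<^sup>2 - 2 * (1 + m * s) * (1 - s)) (at s)"
      by (auto intro!: derivative_eq_intros simp: algebra_simps power2_eq_square)
  qed ((use nz in simp; fail) | algebra)+
  show "(pedersen_C1 m has_real_derivative pedersen_C2 m s) (at s)"
    unfolding pedersen_C1_def[abs_def] pedersen_C2_def
  proof (rule DERIV_quotient_eq)
    show "((\<lambda>s. m * ((1 - m) * (1 + m * s) * (1 - s) - m * (s - 2 - m * s) * (1 - s) + 2 * (s - 2 - m * s) * (1 + m * s))) has_real_derivative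
        m * ((1 - m) * (m * (1 - s) - (1 + m * s)) - m * ((1 - m) * (1 - s) - (s - 2 - m * s)) + 2 * ((1 - m) * (1 + m * s) + m * (s - 2 - m * s)))) (at s)"
      by (auto intro!: derivative_eq_intros simp: algebra_simps)
    show "((\<lambda>s. (1 + m * s)\<^sup>2 * (1 - s) ^ 3) has_real_derivative
        2 * m * (1 + m * s) * (1 - s) ^ 3 - 3 * (1 + m * s)\<^sup>2 * (1 - s)\<^sup>2) (at s)"
      by (auto intro!: derivative_eq_intros simp: algebra_simps power2_eq_square)
  qed ((use nz in simp; fail) | algebra)+
  have "pedersen_B1 m field_differentiable (at s)"
    unfolding pedersen_B1_def[abs_def]
    using nz by (intro derivative_intros) simp_all
  then show "(pedersen_B1 m has_real_derivative deriv (pedersen_B1 m) s) (at s)"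
    by (simp add: DERIV_deriv_iff_field_differentiable)
qed

text \<open>
  The rational identities behind the curvature formula. The variables are the metric coefficients and their
  derivatives divided by \<open>A\<close> (\<open>t = A'/A\<close>, \<open>y = B/A\<close>, \<open>z = C/A\<close>, and \<open>t2, y1, z1, z2\<close> for the further
  derivatives), described by equations without denominators. Each identity is multiplied by a monomial in
  \<open>\<alpha>, \<beta>, \<delta>\<close> chosen such that every term becomes a product of left-hand sides of these
  equations; after substitution a polynomial identity in \<open>m\<close> and \<open>s\<close> remains.
\<close>

lemma pedersen_scaled_coefficients:
  fixes m s :: real
  defines "\<alpha> \<equiv> 1 + m * s" and "\<beta> \<equiv> 1 + m * s\<^sup>2" and "\<delta> \<equiv> 1 - s" and "\<nu> \<equiv> s - 2 - m * s"
  assumes nz: "\<alpha> \<noteq> 0" "\<beta> \<noteq> 0" "\<delta> \<noteq> 0"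
    and t: "t * (\<alpha> * \<delta>) = m + 2 + m * s" and t2: "t2 * (\<alpha> * \<delta>\<^sup>2) = 4 * m + 6 + 2 * m * s"
    and y: "y * \<beta> = - m * s"
    and y1: "y1 * (\<alpha> * \<beta>\<^sup>2 * \<delta>) = - m * ((1 + 2 * m * s) * \<beta> * \<delta> - 2 * m * s\<^sup>2 * \<alpha> * \<delta> + 2 * s * \<alpha> * \<beta>)"
    and z: "z * \<alpha>\<^sup>2 = m * \<nu>"
    and z1: "z1 * (\<alpha> ^ 3 * \<delta>) = m * ((1 - m) * \<alpha> * \<delta> - m * \<nu> * \<delta> + 2 * \<nu> * \<alpha>)"
    and z2: "z2 * (\<alpha> ^ 4 * \<delta>\<^sup>2) = m * (- 2 * m * (1 - m) * \<alpha> * \<delta>\<^sup>2 + 4 * (1 - m) * \<alpha>\<^sup>2 * \<delta> + 2 * m\<^sup>2 * \<nu> * \<delta>\<^sup>2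
          - 4 * m * \<nu> * \<alpha> * \<delta> + 6 * \<nu> * \<alpha>\<^sup>2)"
    and ka: "ka * (\<alpha>\<^sup>2 * \<delta>\<^sup>2) = - 4 * \<alpha> ^ 3 - 2 * m * \<delta> ^ 3"
    and mu: "\<mu> * \<alpha>\<^sup>2 = - 3 * m * (1 + m)"
    and et: "\<eta> * \<alpha> ^ 3 = 6 * m * \<delta>"
    and kc: "kc * \<beta> = m * \<nu>"
  shows "y - 2 * t + (- m * s * s\<^sup>2 - s) * (y - t)\<^sup>2 = ka + \<mu> * s" (is "?l0 = ?r0")
    and "y1 - 2 * t2 + t\<^sup>2 - 2 * t * (y - t) - s * (y - t) * y1 - m * s * s * (y - t) * (2 * t + s * y1) = ka * y - \<mu>"  (is "?l1 = ?r1")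
    and "- z1 + s * (y - t) * z1 + 2 * z * (y - t) + z\<^sup>2 + m * s * s * (y - t) * (2 * z + s * z1) = ka * z - \<mu>"  (is "?l2 = ?r2")
    and "- 2 * z2 + 4 * t * z1 + s * y1 * z1 + 2 * y1 * z + s * z1\<^sup>2 + 2 * z * z1
       + m * s * (2 * t + s * y1) * (2 * z + s * z1) - kc * (t + z + s * z1)\<^sup>2 = ka * y * z + \<eta> * m\<^sup>2 / \<alpha>"  (is "?l3 = ?r3")
    and "- 6 * z1 + 6 * t * z = - 2 * \<eta> * m + 2 * \<mu>" (is "?l4 = ?r4")
    and "- 3 * z = \<eta> * \<alpha> - \<mu> * s"  (is "?l5 = ?r5")
proof -
  note greek = \<alpha>_def \<beta>_def \<delta>_def \<nu>_def
  have "(y - t) * (\<alpha> * \<beta> * \<delta>) = (y * \<beta>) * \<alpha> * \<delta> - t * (\<alpha> * \<delta>) * \<beta>" by algebra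
  then have w: "(y - t) * (\<alpha> * \<beta> * \<delta>) = - (m + 2 + 2 * m * s + 2 * m\<^sup>2 * s\<^sup>2 + m * s\<^sup>2)"
    unfolding y t unfolding greek by algebra
  have "(2 * t + s * y1) * (\<alpha> * \<beta>\<^sup>2 * \<delta>) = 2 * (t * (\<alpha> * \<delta>)) * \<beta>\<^sup>2 + s * (y1 * (\<alpha> * \<beta>\<^sup>2 * \<delta>))" by algebra
  \<comment> \<open>The combinations \<open>k2\<close>, \<open>k3\<close>, \<open>l\<close> of \<open>metric_riemann_eq\<close>, divided by \<open>A\<close>.\<close>
  note k2 = this[unfolded y1 t]
  have "(2 * z + s * z1) * (\<alpha> ^ 3 * \<delta>) = 2 * (z * \<alpha>\<^sup>2) * \<alpha> * \<delta> + s * (z1 * (\<alpha> ^ 3 * \<delta>))" by algebra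
  note k3 = this[unfolded z z1]
  have "(t + z + s * z1) * (\<alpha> ^ 3 * \<delta>) = t * (\<alpha> * \<delta>) * \<alpha>\<^sup>2 + (z * \<alpha>\<^sup>2) * \<alpha> * \<delta> + s * (z1 * (\<alpha> ^ 3 * \<delta>))" by algebra
  then have l: "(t + z + s * z1) * (\<alpha> ^ 3 * \<delta>) = 2 * m * s * \<alpha> * \<delta> - \<beta> * m * \<delta> + 2 * \<beta> * \<alpha>"
    unfolding t z z1 unfolding greek by algebra
  have *: "l = r" if "(l - r) * D = N" "N = 0" "D \<noteq> 0" for l r D N :: real using that by simp
  show "?l5 = ?r5"
  proof (rule *)
    show "(?l5 - ?r5) * \<alpha>\<^sup>2 = - 3 * (z * \<alpha>\<^sup>2) - \<eta> * \<alpha> ^ 3 + \<mu> * \<alpha>\<^sup>2 * s" by algebra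
    show "\<dots> = 0" unfolding z et mu unfolding greek by algebra
  qed (use nz in simp)
  show "?l4 = ?r4"
  proof (rule *)
    show "(?l4 - ?r4) * (\<alpha> ^ 3 * \<delta>) = - 6 * (z1 * (\<alpha> ^ 3 * \<delta>)) + 6 * (t * (\<alpha> * \<delta>)) * (z * \<alpha>\<^sup>2)
       + 2 * (\<eta> * \<alpha> ^ 3) * \<delta> * m - 2 * (\<mu> * \<alpha>\<^sup>2) * \<alpha> * \<delta>" by algebra
    show "\<dots> = 0" unfolding z et mu t z1 unfolding greek by algebra
  qed (use nz in simp)
  show "?l0 = ?r0"
  proof (rule *)
    show "(?l0 - ?r0) * (\<alpha>\<^sup>2 * \<beta>\<^sup>2 * \<delta>\<^sup>2) = (y * \<beta>) * \<beta> * \<alpha>\<^sup>2 * \<delta>\<^sup>2 - 2 * (t * (\<alpha> * \<delta>)) * \<alpha> * \<delta> * \<beta>\<^sup>2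
       + (- m * s * s\<^sup>2 - s) * ((y - t) * (\<alpha> * \<beta> * \<delta>))\<^sup>2 - (ka * (\<alpha>\<^sup>2 * \<delta>\<^sup>2)) * \<beta>\<^sup>2 - (\<mu> * \<alpha>\<^sup>2) * \<beta>\<^sup>2 * \<delta>\<^sup>2 * s" by algebra
    show "\<dots> = 0" unfolding w ka mu y t unfolding greek by algebra
  qed (use nz in simp)
  show "?l1 = ?r1"
  proof (rule *)
    show "(?l1 - ?r1) * (\<alpha>\<^sup>2 * \<beta> ^ 3 * \<delta>\<^sup>2) = (y1 * (\<alpha> * \<beta>\<^sup>2 * \<delta>)) * \<alpha> * \<beta> * \<delta> - 2 * (t2 * (\<alpha> * \<delta>\<^sup>2)) * \<alpha> * \<beta> ^ 3
       + (t * (\<alpha> * \<delta>))\<^sup>2 * \<beta> ^ 3 - 2 * (t * (\<alpha> * \<delta>)) * ((y - t) * (\<alpha> * \<beta> * \<delta>)) * \<beta>\<^sup>2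
       - s * ((y - t) * (\<alpha> * \<beta> * \<delta>)) * (y1 * (\<alpha> * \<beta>\<^sup>2 * \<delta>))
       - m * s * s * ((y - t) * (\<alpha> * \<beta> * \<delta>)) * ((2 * t + s * y1) * (\<alpha> * \<beta>\<^sup>2 * \<delta>))
       - (ka * (\<alpha>\<^sup>2 * \<delta>\<^sup>2)) * (y * \<beta>) * \<beta>\<^sup>2 + (\<mu> * \<alpha>\<^sup>2) * \<beta> ^ 3 * \<delta>\<^sup>2" by algebra
    show "\<dots> = 0" unfolding w k2 ka mu y t t2 y1 unfolding greek by algebra
  qed (use nz in simp)
  show "?l2 = ?r2"
  proof (rule *)
    show "(?l2 - ?r2) * (\<alpha> ^ 4 * \<beta> * \<delta>\<^sup>2) = - (z1 * (\<alpha> ^ 3 * \<delta>)) * \<alpha> * \<beta> * \<delta>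
       + s * ((y - t) * (\<alpha> * \<beta> * \<delta>)) * (z1 * (\<alpha> ^ 3 * \<delta>)) + 2 * (z * \<alpha>\<^sup>2) * ((y - t) * (\<alpha> * \<beta> * \<delta>)) * \<alpha> * \<delta>
       + (z * \<alpha>\<^sup>2)\<^sup>2 * \<beta> * \<delta>\<^sup>2 + m * s * s * ((y - t) * (\<alpha> * \<beta> * \<delta>)) * ((2 * z + s * z1) * (\<alpha> ^ 3 * \<delta>))
       - (ka * (\<alpha>\<^sup>2 * \<delta>\<^sup>2)) * (z * \<alpha>\<^sup>2) * \<beta> + (\<mu> * \<alpha>\<^sup>2) * \<alpha>\<^sup>2 * \<beta> * \<delta>\<^sup>2" by algebra
    show "\<dots> = 0" unfolding w k3 ka mu z z1 unfolding greek by algebra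
  qed (use nz in simp)
  show "?l3 = ?r3"
  proof (rule *)
    have "\<eta> * m\<^sup>2 / \<alpha> * \<alpha> ^ 4 = (\<eta> * \<alpha> ^ 3) * m\<^sup>2" using nz by (simp add: field_simps eval_nat_numeral)
    note e4 = this[unfolded et]
    show "(?l3 - ?r3) * (\<alpha> ^ 6 * \<beta> ^ 2 * \<delta>\<^sup>2) = - 2 * (z2 * (\<alpha> ^ 4 * \<delta>\<^sup>2)) * \<alpha>\<^sup>2 * \<beta>\<^sup>2
       + 4 * (t * (\<alpha> * \<delta>)) * (z1 * (\<alpha> ^ 3 * \<delta>)) * \<alpha>\<^sup>2 * \<beta>\<^sup>2
       + s * (y1 * (\<alpha> * \<beta>\<^sup>2 * \<delta>)) * (z1 * (\<alpha> ^ 3 * \<delta>)) * \<alpha>\<^sup>2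
       + 2 * (y1 * (\<alpha> * \<beta>\<^sup>2 * \<delta>)) * (z * \<alpha>\<^sup>2) * \<alpha> ^ 3 * \<delta>
       + s * (z1 * (\<alpha> ^ 3 * \<delta>))\<^sup>2 * \<beta>\<^sup>2
       + 2 * (z * \<alpha>\<^sup>2) * (z1 * (\<alpha> ^ 3 * \<delta>)) * \<alpha> * \<beta>\<^sup>2 * \<delta>
       + m * s * ((2 * t + s * y1) * (\<alpha> * \<beta>\<^sup>2 * \<delta>)) * ((2 * z + s * z1) * (\<alpha> ^ 3 * \<delta>)) * \<alpha>\<^sup>2
       - (kc * \<beta>) * ((t + z + s * z1) * (\<alpha> ^ 3 * \<delta>))\<^sup>2 * \<beta>
       - (ka * (\<alpha>\<^sup>2 * \<delta>\<^sup>2)) * (y * \<beta>) * (z * \<alpha>\<^sup>2) * \<alpha>\<^sup>2 * \<beta>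
       - (\<eta> * m\<^sup>2 / \<alpha> * \<alpha> ^ 4) * \<alpha>\<^sup>2 * \<beta>\<^sup>2 * \<delta>\<^sup>2" unfolding divide_inverse by algebra
    show "\<dots> = 0" unfolding e4 l k2 k3 ka y z y1 z1 z2 kc t unfolding greek by algebra
  qed (use nz in simp)
qed

lemma inner_self_less_1: "x \<in> ball 0 1 \<Longrightarrow> x \<bullet> x < (1::real)"
  by (simp add: dot_square_norm power_less_one_iff abs_square_less_1)

lemma pedersen_denominators:
  fixes m s :: real
  assumes "m \<ge> 0" "s \<ge> 0"
  shows "1 + m * s > 0" "1 + m * s\<^sup>2 > 0"
  using assms by (simp_all add: add_pos_nonneg)

lemma pedersen_radial_coefficient:
  assumes "1 + m * s \<noteq> 0" "1 + m * s\<^sup>2 \<noteq> 0" "1 - s \<noteq> 0"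
  shows "pedersen_A m s + s * pedersen_B m s = (1 + m * s) / ((1 + m * s\<^sup>2) * (1 - s)\<^sup>2)"
proof -
  have "pedersen_A m s + s * pedersen_B m s
      = ((1 + m * s) * (1 + m * s\<^sup>2) - m * s\<^sup>2 * (1 + m * s)) / ((1 + m * s\<^sup>2) * (1 - s)\<^sup>2)"
    using assms by (simp add: pedersen_A_def pedersen_B_def power2_eq_square diff_divide_distrib)
  also have "(1 + m * s) * (1 + m * s\<^sup>2) - m * s\<^sup>2 * (1 + m * s) = 1 + m * s" by algebra
  finally show ?thesis .
qed

lemma pedersen_fibre_coefficient:
  assumes "1 + m * s \<noteq> 0" "1 - s \<noteq> 0"
  shows "pedersen_A m s + s * pedersen_C m s = (1 + m * s\<^sup>2) / ((1 + m * s) * (1 - s)\<^sup>2)"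
proof -
  have "pedersen_A m s + s * pedersen_C m s
      = ((1 + m * s)\<^sup>2 + s * (m * (s - 2 - m * s))) / ((1 + m * s) * (1 - s)\<^sup>2)"
    using assms by (simp add: pedersen_A_def pedersen_C_def power2_eq_square add_divide_distrib)
  also have "(1 + m * s)\<^sup>2 + s * (m * (s - 2 - m * s)) = 1 + m * s\<^sup>2" by algebra
  finally show ?thesis .
qed

text \<open>
  The second derivative of \<open>B\<close> cancels in the curvature by antisymmetry, hence it is given without a closed form.
\<close>

lemma unitary_metric_pedersen:
  assumes "m \<ge> 0"
  shows "unitary_metric hopf_J (ball 0 1) (pedersen_A m) (pedersen_A1 m) (pedersen_A2 m)
    (pedersen_B m) (pedersen_B1 m) (deriv (pedersen_B1 m)) (pedersen_C m) (pedersen_C1 m) (pedersen_C2 m)"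
proof (rule unitary_metric.intro)
  show "linear hopf_J"
    by (rule linearI) (simp_all add: vec_eq_iff forall_4)
  show "hopf_J (hopf_J u) = - u" for u
    by (simp add: vec_eq_iff forall_4)
  show "hopf_J u \<bullet> v = - (hopf_J v \<bullet> u)" for u v
    by (simp add: inner4 algebra_simps)
  fix y :: "real ^ 4" assume "y \<in> ball 0 1"
  then have s: "1 - y \<bullet> y > 0" using inner_self_less_1 by force
  then have nz: "1 + m * (y \<bullet> y) \<noteq> 0" "1 + m * (y \<bullet> y)\<^sup>2 \<noteq> 0" "1 - y \<bullet> y \<noteq> 0"
    using pedersen_denominators[OF assms, of "y \<bullet> y"] by auto
  show "pedersen_A m (y \<bullet> y) \<noteq> 0"
    using nz by (simp add: pedersen_A_def)
  show "pedersen_A m (y \<bullet> y) + (y \<bullet> y) * pedersen_B m (y \<bullet> y) \<noteq> 0"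
    using nz by (simp add: pedersen_radial_coefficient)
  show "pedersen_A m (y \<bullet> y) + (y \<bullet> y) * pedersen_C m (y \<bullet> y) \<noteq> 0"
    using nz by (simp add: pedersen_fibre_coefficient)
  note pedersen_derivatives[OF nz]
  then show "(pedersen_A m has_real_derivative pedersen_A1 m (y \<bullet> y)) (at (y \<bullet> y))"
    "(pedersen_A1 m has_real_derivative pedersen_A2 m (y \<bullet> y)) (at (y \<bullet> y))"
    "(pedersen_B m has_real_derivative pedersen_B1 m (y \<bullet> y)) (at (y \<bullet> y))"
    "(pedersen_B1 m has_real_derivative deriv (pedersen_B1 m) (y \<bullet> y)) (at (y \<bullet> y))"
    "(pedersen_C m has_real_derivative pedersen_C1 m (y \<bullet> y)) (at (y \<bullet> y))"
    "(pedersen_C1 m has_real_derivative pedersen_C2 m (y \<bullet> y)) (at (y \<bullet> y))" by blast+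
qed (rule open_ball)

lemma pedersen_metric_eq:
  assumes "m \<ge> 0"
  shows "pedersen_metric m x u v = pedersen_A m (x \<bullet> x) * (u \<bullet> v)
     + pedersen_B m (x \<bullet> x) * ((x \<bullet> u) * (x \<bullet> v))
     + pedersen_C m (x \<bullet> x) * ((hopf_J x \<bullet> u) * (hopf_J x \<bullet> v))"
proof -
  have J: "hopf_J x \<bullet> w = x$1 * w$4 - x$4 * w$1 - x$2 * w$3 + x$3 * w$2" for w
    by (simp add: inner4)
  show ?thesis
    unfolding pedersen_metric_smooth_form[OF assms] J[symmetric]
    by (simp add: pedersen_A_def pedersen_B_def pedersen_C_def add_divide_distrib diff_divide_distrib ring_distribs mult_ac)
qed

section \<open>The curvature of the Pedersen metric\<close>

text \<open>
  The fundamental form of the almost complex structure whose simple eigenvalue governs the curvature: up to sign it is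
  \<open>e\<^sub>0 \<and> e\<^sub>3 + e\<^sub>1 \<and> e\<^sub>2\<close> for the orthonormal coframe \<open>e\<^sub>0, \<dots>, e\<^sub>3\<close> proportional to \<open>d\<rho>, \<sigma>\<^sub>1, \<sigma>\<^sub>2, \<sigma>\<^sub>3\<close>.
\<close>

definition kaehler_form :: "real \<Rightarrow> real ^ 4 \<Rightarrow> real ^ 4 \<Rightarrow> real ^ 4 \<Rightarrow> real" where
  "kaehler_form m x u v = ((1 + m * (x \<bullet> x)) * (hopf_J u \<bullet> v)
     - m * ((x \<bullet> u) * (hopf_J x \<bullet> v) - (x \<bullet> v) * (hopf_J x \<bullet> u))) / (1 - x \<bullet> x)\<^sup>2"

text \<open>
  The eigenvalues of the Weyl tensor on its nontrivial half are \<open>2 \<Lambda>\<close>, with eigenvector \<open>\<Omega>\<close>, and twice \<open>- \<Lambda>\<close>,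
  for \<open>\<Lambda> = weyl_coefficient m s\<close>.
\<close>

definition weyl_coefficient :: "real \<Rightarrow> real \<Rightarrow> real" where
  "weyl_coefficient m s = 4 * m * ((1 - s) / (1 + m * s)) ^ 3"

text \<open>
  Three vectors in \<open>\<complex>\<^sup>2\<close> are linearly dependent, so the determinant of their Hermitian Gram matrix vanishes.
  The curvature identities for the Pedersen metric hold modulo this relation only.
\<close>

lemma gram_relation_4:
  fixes x u v :: "real ^ 4"
  shows "(x \<bullet> x) * ((u \<bullet> u) * (v \<bullet> v) - (u \<bullet> v)\<^sup>2 - (hopf_J u \<bullet> v)\<^sup>2)
    - ((x \<bullet> u)\<^sup>2 * (v \<bullet> v) - 2 * (x \<bullet> u) * (x \<bullet> v) * (u \<bullet> v) + (x \<bullet> v)\<^sup>2 * (u \<bullet> u))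
    - ((hopf_J x \<bullet> u)\<^sup>2 * (v \<bullet> v) - 2 * (hopf_J x \<bullet> u) * (hopf_J x \<bullet> v) * (u \<bullet> v) + (hopf_J x \<bullet> v)\<^sup>2 * (u \<bullet> u))
    + 2 * ((hopf_J u \<bullet> v) * ((x \<bullet> u) * (hopf_J x \<bullet> v) - (x \<bullet> v) * (hopf_J x \<bullet> u))) = 0"
  unfolding inner4 hopf_J_nth by algebra

text \<open>
  Up to multiples of \<open>\<mu>\<close>, the right-hand sides are the coefficients of \<open>\<kappa> Q + 3/2 \<Lambda> \<Omega>\<^sup>2\<close> in the six
  invariants of \<open>metric_riemann_eq\<close>, where \<open>\<kappa> = - 4 - \<Lambda>/2\<close>; the multiples of \<open>\<mu>\<close> are those of
  \<open>gram_relation_4\<close>.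
\<close>

lemma pedersen_coefficients:
  assumes "m \<ge> 0" and "0 \<le> s" "s < 1"
  defines "a \<equiv> pedersen_A m s" and "a1 \<equiv> pedersen_A1 m s" and "a2 \<equiv> pedersen_A2 m s"
    and "b \<equiv> pedersen_B m s" and "b1 \<equiv> pedersen_B1 m s"
    and "c \<equiv> pedersen_C m s" and "c1 \<equiv> pedersen_C1 m s" and "c2 \<equiv> pedersen_C2 m s"
  defines "k1 \<equiv> s * (b - a1)" and "k2 \<equiv> 2 * a1 + s * b1" and "k3 \<equiv> - (2 * c + s * c1)"
    and "l \<equiv> a1 + c + s * c1"
    and "kb \<equiv> b / (a + s * b)" and "kc \<equiv> c / (a + s * c)"
  defines "\<kappa> \<equiv> - 4 - weyl_coefficient m s / 2" and "\<eta> \<equiv> 3 / 2 * weyl_coefficient m s / (1 - s) ^ 4"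
    and "\<mu> \<equiv> - 3 * m * (1 + m) / ((1 + m * s) * (1 - s)\<^sup>2)"
  shows "b - 2 * a1 + (kb * k1\<^sup>2 - s * (b - a1)\<^sup>2) / a = \<kappa> * a\<^sup>2 + \<mu> * s"
    and "b1 - 2 * a2 + (a1\<^sup>2 - 2 * a1 * (b - a1) - s * (b - a1) * b1 + kb * k1 * k2) / a = \<kappa> * a * b - \<mu>"
    and "- c1 + (s * (b - a1) * c1 + 2 * c * (b - a1) + c\<^sup>2 + kb * k1 * k3) / a = \<kappa> * a * c - \<mu>"
    and "- 2 * c2 + (4 * a1 * c1 + s * b1 * c1 + 2 * b1 * c + s * c1\<^sup>2 + 2 * c * c1
          + kb * k2 * k3 - kc * l\<^sup>2) / a = \<kappa> * b * c + \<eta> * m\<^sup>2"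
    and "- 6 * c1 + 6 * a1 * c / a = - 2 * \<eta> * (1 + m * s) * m + 2 * \<mu>"
    and "- 3 * c = \<eta> * (1 + m * s)\<^sup>2 - \<mu> * s"
proof -
  define \<alpha> \<beta> \<delta> where "\<alpha> = 1 + m * s" and "\<beta> = 1 + m * s\<^sup>2" and "\<delta> = 1 - s"
  note greek = \<alpha>_def[symmetric] \<beta>_def[symmetric] \<delta>_def[symmetric]
  have nz: "\<alpha> \<noteq> 0" "\<beta> \<noteq> 0" "\<delta> \<noteq> 0"
    using pedersen_denominators[OF assms(1,2)] assms(3) by (auto simp: \<alpha>_def \<beta>_def \<delta>_def)
  note defs = a_def a1_def a2_def b_def b1_def c_def c1_def c2_def pedersen_A_def pedersen_A1_def
    pedersen_A2_def pedersen_B_def pedersen_B1_def pedersen_C_def pedersen_C1_def pedersen_C2_def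
    \<kappa>_def \<eta>_def \<mu>_def weyl_coefficient_def greek
  have kb: "kb = - m * s"
    using nz unfolding kb_def a_def b_def
    by (subst pedersen_radial_coefficient) (simp_all add: pedersen_B_def greek)
  have kc: "kc * \<beta> = m * (s - 2 - m * s)"
    using nz unfolding kc_def a_def c_def
    by (subst pedersen_fibre_coefficient) (simp_all add: pedersen_C_def greek)
  have a: "a \<noteq> 0" using nz unfolding defs by simp
  have pow: "\<delta> ^ 3 = \<delta> * \<delta>\<^sup>2" "\<delta> ^ 4 = \<delta>\<^sup>2 * \<delta>\<^sup>2" "\<alpha> ^ 3 = \<alpha> * \<alpha>\<^sup>2" "\<alpha> ^ 4 = \<alpha>\<^sup>2 * \<alpha>\<^sup>2" "\<beta>\<^sup>2 = \<beta> * \<beta>" "\<alpha>\<^sup>2 = \<alpha> * \<alpha>" "\<delta>\<^sup>2 = \<delta> * \<delta>"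
    by (simp_all add: eval_nat_numeral)
  have t: "a1 / a * (\<alpha> * \<delta>) = m + 2 + m * s"
    and t2: "a2 / a * (\<alpha> * \<delta>\<^sup>2) = 4 * m + 6 + 2 * m * s"
    and y: "b / a * \<beta> = - m * s"
    and y1: "b1 / a * (\<alpha> * \<beta>\<^sup>2 * \<delta>) = - m * ((1 + 2 * m * s) * \<beta> * \<delta> - 2 * m * s\<^sup>2 * \<alpha> * \<delta> + 2 * s * \<alpha> * \<beta>)"
    and z: "c / a * \<alpha>\<^sup>2 = m * (s - 2 - m * s)"
    and z1: "c1 / a * (\<alpha> ^ 3 * \<delta>) = m * ((1 - m) * \<alpha> * \<delta> - m * (s - 2 - m * s) * \<delta> + 2 * (s - 2 - m * s) * \<alpha>)"
    and z2: "c2 / a * (\<alpha> ^ 4 * \<delta>\<^sup>2) = m * (- 2 * m * (1 - m) * \<alpha> * \<delta>\<^sup>2 + 4 * (1 - m) * \<alpha>\<^sup>2 * \<delta> + 2 * m\<^sup>2 * (s - 2 - m * s) * \<delta>\<^sup>2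
          - 4 * m * (s - 2 - m * s) * \<alpha> * \<delta> + 6 * (s - 2 - m * s) * \<alpha>\<^sup>2)"
    using nz unfolding defs by (simp_all add: pow)
  have ka: "\<kappa> * a * (\<alpha>\<^sup>2 * \<delta>\<^sup>2) = - 4 * \<alpha> ^ 3 - 2 * m * \<delta> ^ 3"
    using nz unfolding defs by (simp add: power_divide field_simps eval_nat_numeral)
  have mu: "\<mu> / a * \<alpha>\<^sup>2 = - 3 * m * (1 + m)"
    using nz unfolding defs by (simp add: pow)
  have et: "\<eta> * \<alpha> / a * \<alpha> ^ 3 = 6 * m * \<delta>"
    using nz unfolding defs by (simp add: power_divide pow)
  define t t2 y y1 z z1 z2 M e where "t = a1 / a" and "t2 = a2 / a" and "y = b / a" and "y1 = b1 / a"
    and "z = c / a" and "z1 = c1 / a" and "z2 = c2 / a" and "M = \<mu> / a" and "e = \<eta> * \<alpha> / a"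
  note scaled = pedersen_scaled_coefficients[where m = m and s = s, folded \<alpha>_def \<beta>_def \<delta>_def,
      OF nz t t2 y y1 z z1 z2 ka mu et kc, folded t_def t2_def y_def y1_def z_def z1_def z2_def M_def e_def]
  have unscaled: "a1 = a * t" "a2 = a * t2" "b = a * y" "b1 = a * y1" "c = a * z" "c1 = a * z1" "c2 = a * z2"
    "\<mu> = a * M"
    using a by (simp_all add: t_def t2_def y_def y1_def z_def z1_def z2_def M_def)
  have \<eta>: "\<eta> * \<alpha> = a * e"
    using a by (simp add: e_def)
  have *: "L + X / a = R" if "X = a * Y" "L + Y = R" for L X Y R
    using that a by simp
  show "b - 2 * a1 + (kb * k1\<^sup>2 - s * (b - a1)\<^sup>2) / a = \<kappa> * a\<^sup>2 + \<mu> * s"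
  proof (rule *[where Y = "a * ((- m * s * s\<^sup>2 - s) * (y - t)\<^sup>2)"])
  qed (unfold kb k1_def unscaled, algebra, insert scaled(1), algebra)
  show "b1 - 2 * a2 + (a1\<^sup>2 - 2 * a1 * (b - a1) - s * (b - a1) * b1 + kb * k1 * k2) / a = \<kappa> * a * b - \<mu>"
  proof (rule *[where Y = "a * (t\<^sup>2 - 2 * t * (y - t) - s * (y - t) * y1 - m * s * s * (y - t) * (2 * t + s * y1))"])
  qed (unfold kb k1_def k2_def unscaled, algebra, insert scaled(2), algebra)
  show "- c1 + (s * (b - a1) * c1 + 2 * c * (b - a1) + c\<^sup>2 + kb * k1 * k3) / a = \<kappa> * a * c - \<mu>"
  proof (rule *[where Y = "a * (s * (y - t) * z1 + 2 * z * (y - t) + z\<^sup>2 + m * s * s * (y - t) * (2 * z + s * z1))"])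
  qed (unfold kb k1_def k3_def unscaled, algebra, insert scaled(3), algebra)
  show "- 2 * c2 + (4 * a1 * c1 + s * b1 * c1 + 2 * b1 * c + s * c1\<^sup>2 + 2 * c * c1
          + kb * k2 * k3 - kc * l\<^sup>2) / a = \<kappa> * b * c + \<eta> * m\<^sup>2"
  proof (rule *[where Y = "a * (4 * t * z1 + s * y1 * z1 + 2 * y1 * z + s * z1\<^sup>2 + 2 * z * z1
       + m * s * (2 * t + s * y1) * (2 * z + s * z1) - kc * (t + z + s * z1)\<^sup>2)"])
    have "e * m\<^sup>2 / \<alpha> * a = \<eta> * m\<^sup>2" using nz \<eta> by (simp add: field_simps)
    with scaled(4) show "- 2 * c2 + a * (4 * t * z1 + s * y1 * z1 + 2 * y1 * z + s * z1\<^sup>2 + 2 * z * z1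
       + m * s * (2 * t + s * y1) * (2 * z + s * z1) - kc * (t + z + s * z1)\<^sup>2) = \<kappa> * b * c + \<eta> * m\<^sup>2"
      unfolding unscaled by algebra
  qed (unfold kb l_def k2_def k3_def unscaled, algebra)
  show "- 6 * c1 + 6 * a1 * c / a = - 2 * \<eta> * (1 + m * s) * m + 2 * \<mu>"
    unfolding greek
  proof (rule *[where Y = "a * (6 * t * z)"])
    show "- 6 * c1 + a * (6 * t * z) = - 2 * \<eta> * \<alpha> * m + 2 * \<mu>"
      using scaled(5) \<eta> unfolding unscaled by algebra
  qed (unfold unscaled, algebra)
  show "- 3 * c = \<eta> * (1 + m * s)\<^sup>2 - \<mu> * s"
    unfolding greek unscaled using scaled(6) \<eta> by algebra
qed

text \<open>
  The curvature operator of a half conformally flat Einstein metric, evaluated on \<open>u \<and> v\<close>, whose squared norm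
  is \<open>Q\<close>. The scalar part is \<open>- 4 Q\<close>. Both halves of a decomposable bivector have squared norm \<open>Q/2\<close>, so the double
  eigenvalue \<open>- \<Lambda>\<close> of the Weyl tensor contributes \<open>- \<Lambda>/2 \<cdot> Q\<close>. The component along \<open>\<Omega>\<close>, of squared
  norm \<open>\<Omega>(u,v)\<^sup>2 / 2\<close>, has the eigenvalue \<open>2 \<Lambda>\<close>, which is larger by \<open>3 \<Lambda>\<close>.
\<close>

theorem metric_riemann_pedersen:
  fixes x u v :: "real ^ 4"
  assumes m: "m \<ge> 0" and x: "x \<in> ball 0 1"
  defines "g \<equiv> pedersen_metric m" and "\<Lambda> \<equiv> weyl_coefficient m (x \<bullet> x)"
  shows "g x (riemann g x u v v) u =
    - (4 + \<Lambda> / 2) * (g x u u * g x v v - (g x u v)\<^sup>2) + 3 / 2 * \<Lambda> * (kaehler_form m x u v)\<^sup>2"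
proof -
  interpret unitary_metric hopf_J "ball 0 1" "pedersen_A m" "pedersen_A1 m" "pedersen_A2 m"
    "pedersen_B m" "pedersen_B1 m" "deriv (pedersen_B1 m)" "pedersen_C m" "pedersen_C1 m" "pedersen_C2 m"
    by (rule unitary_metric_pedersen[OF m])
  have metric: "metric = g"
    by (intro ext) (simp add: metric_def g_def pedersen_metric_eq[OF m])
  define s p q \<theta> \<phi> \<omega> U V h where "s = x \<bullet> x" and "p = x \<bullet> u" and "q = x \<bullet> v"
    and "\<theta> = hopf_J x \<bullet> u" and "\<phi> = hopf_J x \<bullet> v" and "\<omega> = hopf_J u \<bullet> v"
    and "U = u \<bullet> u" and "V = v \<bullet> v" and "h = u \<bullet> v"
  note folds = s_def[symmetric] p_def[symmetric] q_def[symmetric] \<theta>_def[symmetric] \<phi>_def[symmetric]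
    \<omega>_def[symmetric] U_def[symmetric] V_def[symmetric] h_def[symmetric]
  define a b c where "a = pedersen_A m s" and "b = pedersen_B m s" and "c = pedersen_C m s"
  define \<eta> \<mu> where "\<eta> = 3 / 2 * \<Lambda> / (1 - s) ^ 4"
    and "\<mu> = - 3 * m * (1 + m) / ((1 + m * s) * (1 - s)\<^sup>2)"
  have s: "0 \<le> s" "s < 1"
    using inner_self_less_1[OF x] by (simp_all add: s_def)
  note fold_coefficients = a_def[symmetric] b_def[symmetric] c_def[symmetric] \<Lambda>_def[unfolded folds, symmetric]
    \<eta>_def[symmetric] \<mu>_def[symmetric]
  note riemann = metric_riemann_eq[OF x, of u v, unfolded metric folds,
      unfolded pedersen_coefficients(1-5)[OF m s], unfolded fold_coefficients]
  note coefficient6 = pedersen_coefficients(6)[OF m s, unfolded fold_coefficients]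
  have c: "3 * c = \<mu> * s - \<eta> * (1 + m * s)\<^sup>2"
    using coefficient6 by simp
  have relation: "s * (U * V - h\<^sup>2 - \<omega>\<^sup>2) - (p\<^sup>2 * V - 2 * p * q * h + q\<^sup>2 * U)
      - (\<theta>\<^sup>2 * V - 2 * \<theta> * \<phi> * h + \<phi>\<^sup>2 * U) + 2 * (\<omega> * (p * \<phi> - q * \<theta>)) = 0"
    using gram_relation_4[of x u v] unfolding folds .
  have gram: "g x u u * g x v v - (g x u v)\<^sup>2 = a\<^sup>2 * (U * V - h\<^sup>2)
      + a * b * (p\<^sup>2 * V - 2 * p * q * h + q\<^sup>2 * U)
      + a * c * (\<theta>\<^sup>2 * V - 2 * \<theta> * \<phi> * h + \<phi>\<^sup>2 * U) + b * c * (p * \<phi> - q * \<theta>)\<^sup>2"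
    unfolding g_def pedersen_metric_eq[OF m] folds a_def[symmetric] b_def[symmetric] c_def[symmetric]
    by algebra
  have "(1 - s) ^ 4 \<noteq> 0" using s by simp
  then have form: "3 / 2 * \<Lambda> * (kaehler_form m x u v)\<^sup>2 = \<eta> * ((1 + m * s) * \<omega> - m * (p * \<phi> - q * \<theta>))\<^sup>2"
    unfolding kaehler_form_def \<eta>_def folds by (simp add: power_divide power2_eq_square eval_nat_numeral)
  have "g x (riemann g x u v v) u =
      (- 4 - \<Lambda> / 2) * (a\<^sup>2 * (U * V - h\<^sup>2)
        + a * b * (p\<^sup>2 * V - 2 * p * q * h + q\<^sup>2 * U)
        + a * c * (\<theta>\<^sup>2 * V - 2 * \<theta> * \<phi> * h + \<phi>\<^sup>2 * U) + b * c * (p * \<phi> - q * \<theta>)\<^sup>2)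
      + \<eta> * ((1 + m * s) * \<omega> - m * (p * \<phi> - q * \<theta>))\<^sup>2
      + \<mu> * (s * (U * V - h\<^sup>2 - \<omega>\<^sup>2) - (p\<^sup>2 * V - 2 * p * q * h + q\<^sup>2 * U)
      - (\<theta>\<^sup>2 * V - 2 * \<theta> * \<phi> * h + \<phi>\<^sup>2 * U) + 2 * (\<omega> * (p * \<phi> - q * \<theta>)))"
    unfolding riemann c by algebra
  then show ?thesis
    unfolding relation gram form by simp
qed

section \<open>The range of the sectional curvature\<close>

lemma pedersen_metric_bilinear: "m \<ge> 0 \<Longrightarrow> bilinear (pedersen_metric m x)"
  unfolding bilinear_def
  by (auto intro!: linearI simp: pedersen_metric_eq inner_add_left inner_add_right algebra_simps)

lemma pedersen_metric_commute: "m \<ge> 0 \<Longrightarrow> pedersen_metric m x u v = pedersen_metric m x v u"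
  by (simp add: pedersen_metric_eq inner_commute mult.commute)

text \<open>
  By Bessel's inequality \<open>(x \<bullet> u)\<^sup>2 + (J x \<bullet> u)\<^sup>2 \<le> \<bar>x\<bar>\<^sup>2 \<bar>u\<bar>\<^sup>2\<close>, and the metric is positive on each of \<open>x\<close>, \<open>J x\<close> and their
  orthogonal complement.
\<close>

lemma pedersen_metric_pos:
  assumes m: "m \<ge> 0" and x: "x \<in> ball 0 1" and u: "u \<noteq> 0"
  shows "pedersen_metric m x u u > 0"
proof (cases "x = 0")
  case True
  then show ?thesis using u by (simp add: pedersen_metric_def)
next
  case False
  define s where "s = x \<bullet> x"
  define p \<theta> where "p = x \<bullet> u" and "\<theta> = hopf_J x \<bullet> u"
  have s: "0 < s" "s < 1"
    using inner_self_less_1[OF x] False by (simp_all add: s_def)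
  note pos = pedersen_denominators[OF m less_imp_le[OF s(1)]]
  have "s * (u \<bullet> u) - p\<^sup>2 - \<theta>\<^sup>2 = (x$1 * u$2 - x$2 * u$1 - x$3 * u$4 + x$4 * u$3)\<^sup>2
      + (x$1 * u$3 - x$3 * u$1 - x$4 * u$2 + x$2 * u$4)\<^sup>2"
    unfolding s_def p_def \<theta>_def inner4 hopf_J_nth by algebra
  then have bessel: "s * (u \<bullet> u) - p\<^sup>2 - \<theta>\<^sup>2 \<ge> 0" by simp
  have A: "pedersen_A m s > 0" and E: "pedersen_A m s + s * pedersen_B m s > 0"
    and F: "pedersen_A m s + s * pedersen_C m s > 0"
    using pos s by (simp add: pedersen_A_def, simp add: pedersen_radial_coefficient,
        simp add: pedersen_fibre_coefficient)
  have eq: "s * pedersen_metric m x u u = pedersen_A m s * (s * (u \<bullet> u) - p\<^sup>2 - \<theta>\<^sup>2)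
      + (pedersen_A m s + s * pedersen_B m s) * p\<^sup>2 + (pedersen_A m s + s * pedersen_C m s) * \<theta>\<^sup>2"
    unfolding pedersen_metric_eq[OF m] s_def p_def \<theta>_def by algebra
  have "s * pedersen_metric m x u u > 0"
  proof (cases "p = 0 \<and> \<theta> = 0")
    case True
    then show ?thesis unfolding eq using A s u by simp
  next
    case False
    then have "p\<^sup>2 > 0 \<or> \<theta>\<^sup>2 > 0" by simp
    then have "(pedersen_A m s + s * pedersen_B m s) * p\<^sup>2 + (pedersen_A m s + s * pedersen_C m s) * \<theta>\<^sup>2 > 0"
      using E F by (auto intro: add_pos_nonneg add_nonneg_pos)
    moreover have "pedersen_A m s * (s * (u \<bullet> u) - p\<^sup>2 - \<theta>\<^sup>2) \<ge> 0"
      using A bessel by simp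
    ultimately show ?thesis unfolding eq by linarith
  qed
  then show ?thesis using s by (simp add: zero_less_mult_iff)
qed

text \<open>
  The endomorphism \<open>I\<close> that represents \<open>kaehler_form\<close> in the Pedersen metric, obtained by applying the
  inverse metric to \<open>\<Omega>(u, \<cdot>)\<close>.
\<close>

definition almost_complex :: "real \<Rightarrow> real ^ 4 \<Rightarrow> real ^ 4 \<Rightarrow> real ^ 4" where
  "almost_complex m x u = hopf_J u
     + (m * (1 - x \<bullet> x) / (1 + m * (x \<bullet> x)) * (hopf_J x \<bullet> u)) *\<^sub>R x
     + (m * (1 - x \<bullet> x) / (1 + m * (x \<bullet> x)\<^sup>2) * (x \<bullet> u)) *\<^sub>R hopf_J x"

lemma
  assumes m: "m \<ge> 0" and x: "x \<in> ball 0 1"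
  shows metric_almost_complex: "pedersen_metric m x (almost_complex m x u) v = kaehler_form m x u v"
    and metric_almost_complex_self:
      "pedersen_metric m x (almost_complex m x u) (almost_complex m x u) = pedersen_metric m x u u"
proof -
  define s p \<theta> \<alpha> \<beta> \<delta> where "s = x \<bullet> x" and "p = x \<bullet> u" and "\<theta> = hopf_J x \<bullet> u"
    and "\<alpha> = 1 + m * s" and "\<beta> = 1 + m * s\<^sup>2" and "\<delta> = 1 - s"
  have nz: "\<alpha> \<noteq> 0" "\<beta> \<noteq> 0" "\<delta> \<noteq> 0"
    using pedersen_denominators[OF m, of s] inner_self_less_1[OF x] by (auto simp: \<alpha>_def \<beta>_def \<delta>_def s_def)
  have J: "x \<bullet> hopf_J u = - \<theta>" "x \<bullet> hopf_J x = 0" "hopf_J x \<bullet> x = 0" "hopf_J x \<bullet> hopf_J u = p" "hopf_J u \<bullet> hopf_J u = u \<bullet> u"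
    "hopf_J u \<bullet> hopf_J x = p" "hopf_J u \<bullet> x = - \<theta>" "hopf_J x \<bullet> hopf_J x = s"
    by (simp_all add: inner4 p_def \<theta>_def s_def)
  let ?I = "almost_complex m x u"
  have I: "w \<bullet> ?I = w \<bullet> hopf_J u + m * \<delta> / \<alpha> * \<theta> * (w \<bullet> x) + m * \<delta> / \<beta> * p * (w \<bullet> hopf_J x)" for w
    unfolding almost_complex_def by (simp add: inner_add_right \<alpha>_def \<beta>_def \<delta>_def s_def p_def \<theta>_def)
  have xI: "x \<bullet> ?I = - \<beta> / \<alpha> * \<theta>"
  proof -
    have "x \<bullet> ?I = (m * \<delta> * s - \<alpha>) / \<alpha> * \<theta>"
      unfolding I J s_def[symmetric] using nz by (simp add: field_simps)
    also have "m * \<delta> * s - \<alpha> = - \<beta>" unfolding \<alpha>_def \<beta>_def \<delta>_def by algebra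
    finally show ?thesis .
  qed
  have JI: "hopf_J x \<bullet> ?I = \<alpha> / \<beta> * p"
  proof -
    have "hopf_J x \<bullet> ?I = (m * \<delta> * s + \<beta>) / \<beta> * p"
      unfolding I J s_def[symmetric] using nz by (simp add: field_simps)
    also have "m * \<delta> * s + \<beta> = \<alpha>" unfolding \<alpha>_def \<beta>_def \<delta>_def by algebra
    finally show ?thesis .
  qed
  have nu: "s - 2 - m * s = - \<beta> - \<alpha> * \<delta>" unfolding \<alpha>_def \<beta>_def \<delta>_def by algebra
  have s1: "\<delta> = 1 - s" unfolding \<delta>_def ..
  have Om: "kaehler_form m x u v = (\<alpha> * (hopf_J u \<bullet> v) - m * (p * (hopf_J x \<bullet> v) - (x \<bullet> v) * \<theta>)) / \<delta>\<^sup>2" for v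
    unfolding kaehler_form_def \<alpha>_def \<delta>_def p_def \<theta>_def s_def ..
  have abc: "pedersen_A m (x \<bullet> x) = \<alpha> / \<delta>\<^sup>2" "pedersen_B m (x \<bullet> x) = - m * s * \<alpha> / (\<beta> * \<delta>\<^sup>2)"
    "pedersen_C m (x \<bullet> x) = m * (- \<beta> - \<alpha> * \<delta>) / (\<alpha> * \<delta>\<^sup>2)"
    unfolding nu[symmetric] by (simp_all add: pedersen_A_def pedersen_B_def pedersen_C_def \<alpha>_def \<beta>_def \<delta>_def s_def)
  show *: "pedersen_metric m x ?I v = kaehler_form m x u v" for v
  proof -
    have "?I \<bullet> v = hopf_J u \<bullet> v + m * \<delta> / \<alpha> * \<theta> * (x \<bullet> v) + m * \<delta> / \<beta> * p * (hopf_J x \<bullet> v)"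
      using I[of v] by (simp add: inner_commute)
    then have "pedersen_metric m x ?I v = (\<alpha> * (hopf_J u \<bullet> v) + (m * \<delta> + m * s) * (\<theta> * (x \<bullet> v))
        + (m * \<alpha> * \<delta> + m * (- \<beta> - \<alpha> * \<delta>)) / \<beta> * (p * (hopf_J x \<bullet> v))) / \<delta>\<^sup>2"
      unfolding pedersen_metric_eq[OF m] abc xI JI using nz by (simp add: divide_simps) algebra
    also have "m * \<delta> + m * s = m" by (simp add: s1 algebra_simps)
    also have "(m * \<alpha> * \<delta> + m * (- \<beta> - \<alpha> * \<delta>)) / \<beta> = - m" using nz by (simp add: field_simps)
    finally show ?thesis unfolding Om by (simp add: algebra_simps)
  qed
  show "pedersen_metric m x ?I ?I = pedersen_metric m x u u"
  proof -
    have "hopf_J u \<bullet> ?I = u \<bullet> u - m * \<delta> / \<alpha> * \<theta>\<^sup>2 + m * \<delta> / \<beta> * p\<^sup>2"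
      unfolding I J by (simp add: power2_eq_square)
    then have "pedersen_metric m x ?I ?I = (\<alpha> * (u \<bullet> u) + m * \<alpha> * (\<delta> - 1) / \<beta> * p\<^sup>2
        - m * (\<beta> + \<alpha> * \<delta>) / \<alpha> * \<theta>\<^sup>2) / \<delta>\<^sup>2"
      unfolding * Om xI JI using nz by (simp add: divide_simps) algebra
    also have "\<delta> - 1 = - s" unfolding s1 by simp
    also have "(\<alpha> * (u \<bullet> u) + m * \<alpha> * (- s) / \<beta> * p\<^sup>2
        - m * (\<beta> + \<alpha> * \<delta>) / \<alpha> * \<theta>\<^sup>2) / \<delta>\<^sup>2 = pedersen_metric m x u u"
      unfolding pedersen_metric_eq[OF m] abc p_def[symmetric] \<theta>_def[symmetric]
      using nz by (simp add: divide_simps) algebra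
    finally show ?thesis .
  qed
qed

lemma independent_pair_iff:
  fixes u v :: "'a::real_vector"
  shows "u \<noteq> v \<and> independent {u, v} \<longleftrightarrow> u \<noteq> 0 \<and> (\<forall>k. v \<noteq> k *\<^sub>R u)"
proof -
  have "{u, v} = insert v {u}" by auto
  moreover have "\<forall>k. v \<noteq> k *\<^sub>R u \<Longrightarrow> u \<noteq> v" using scaleR_one by metis
  ultimately show ?thesis
    by (auto simp: independent_insert span_singleton)
qed

definition gram :: "('a \<Rightarrow> 'a \<Rightarrow> real) \<Rightarrow> 'a \<Rightarrow> 'a \<Rightarrow> real" where
  "gram b u v = b u u * b v v - (b u v)\<^sup>2"

lemma gram_expand:
  assumes "bilinear b" and "\<And>u v. b u v = b v u"
  shows "b (b u u *\<^sub>R v - b u v *\<^sub>R u - c *\<^sub>R w) (b u u *\<^sub>R v - b u v *\<^sub>R u - c *\<^sub>R w)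
    = b u u * gram b u v - 2 * c * (b u u * b w v - b u v * b w u) + c\<^sup>2 * b w w"
  unfolding gram_def bilinear_lsub[OF assms(1)] bilinear_rsub[OF assms(1)]
    bilinear_lmul[OF assms(1)] bilinear_rmul[OF assms(1)] real_scaleR_def
    assms(2)[of v u] assms(2)[of v w] assms(2)[of u w]
  by algebra

lemma gram_pos:
  assumes b: "bilinear b" "\<And>u v. b u v = b v u" "\<And>u. u \<noteq> 0 \<Longrightarrow> b u u > 0"
    and "u \<noteq> 0" "\<forall>k. v \<noteq> k *\<^sub>R u"
  shows "gram b u v > 0"
proof -
  have N: "b u u > 0" using assms by blast
  have "b u u *\<^sub>R v - b u v *\<^sub>R u \<noteq> 0"
  proof
    assume "b u u *\<^sub>R v - b u v *\<^sub>R u = 0"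
    then have "(1 / b u u) *\<^sub>R (b u u *\<^sub>R v) = (1 / b u u) *\<^sub>R (b u v *\<^sub>R u)" by simp
    then show False using N assms(5) by simp
  qed
  from b(3)[OF this] have "b u u * gram b u v > 0"
    using gram_expand[OF b(1,2), of u v 0 u] by simp
  then show ?thesis using N by (simp add: zero_less_mult_iff)
qed

text \<open>
  Bessel's inequality for \<open>v\<close> and the orthogonal vectors \<open>u\<close>, \<open>w\<close> of equal length.
\<close>

lemma gram_bound:
  assumes b: "bilinear b" "\<And>u v. b u v = b v u" "\<And>u. u \<noteq> 0 \<Longrightarrow> b u u > 0"
    and "u \<noteq> 0" "b w u = 0" "b w w = b u u"
  shows "(b w v)\<^sup>2 \<le> gram b u v"
proof -
  have N: "b u u > 0" using assms by blast
  have "b z z \<ge> 0" for z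
    using b(3)[of z] bilinear_lzero[OF b(1), of z] by (cases "z = 0") auto
  from this[of "b u u *\<^sub>R v - b u v *\<^sub>R u - b w v *\<^sub>R w"]
  have "b u u * (gram b u v - (b w v)\<^sup>2) \<ge> 0"
    unfolding gram_expand[OF b(1,2)] using assms(5,6) by (simp add: power2_eq_square algebra_simps)
  then show ?thesis using N by (simp add: zero_le_mult_iff)
qed

lemma kaehler_form_self [simp]: "kaehler_form m x u u = 0"
  by (simp add: kaehler_form_def inner4)

context
  fixes m :: real and x :: "real ^ 4"
  assumes m: "m \<ge> 0" and x: "x \<in> ball 0 1"
begin

lemma sectional_curvature_pedersen:
  assumes "u \<noteq> 0" "\<forall>k. v \<noteq> k *\<^sub>R u"
  shows "sectional_curvature (pedersen_metric m) x u v =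
     - (4 + weyl_coefficient m (x \<bullet> x) / 2)
     + 3 / 2 * weyl_coefficient m (x \<bullet> x) * ((kaehler_form m x u v)\<^sup>2 / gram (pedersen_metric m x) u v)"
proof -
  have "gram (pedersen_metric m x) u v > 0"
    using m x assms by (intro gram_pos pedersen_metric_bilinear pedersen_metric_commute pedersen_metric_pos)
  then show ?thesis
    unfolding sectional_curvature_def metric_riemann_pedersen[OF m x] gram_def[symmetric]
    by (simp add: add_divide_distrib)
qed

lemma kaehler_form_bound:
  assumes "u \<noteq> 0"
  shows "(kaehler_form m x u v)\<^sup>2 \<le> gram (pedersen_metric m x) u v"
  unfolding metric_almost_complex[OF m x, symmetric]
proof (rule gram_bound[OF pedersen_metric_bilinear[OF m] pedersen_metric_commute[OF m]
      pedersen_metric_pos[OF m x] assms])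
  show "pedersen_metric m x (almost_complex m x u) u = 0"
    by (simp add: metric_almost_complex[OF m x])
  show "pedersen_metric m x (almost_complex m x u) (almost_complex m x u) = pedersen_metric m x u u"
    by (rule metric_almost_complex_self[OF m x])
qed

lemma weyl_coefficient_nonneg: "weyl_coefficient m (x \<bullet> x) \<ge> 0"
  using m inner_self_less_1[OF x] by (simp add: weyl_coefficient_def)

lemma sectional_curvatures_le:
  assumes "K \<in> sectional_curvatures (pedersen_metric m) x"
  shows "K \<le> weyl_coefficient m (x \<bullet> x) - 4"
proof -
  obtain u v where K: "K = sectional_curvature (pedersen_metric m) x u v"
    and uv: "u \<noteq> 0" "\<forall>k. v \<noteq> k *\<^sub>R u"
    using assms unfolding sectional_curvatures_def independent_pair_iff by blast
  have "gram (pedersen_metric m x) u v > 0"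
    using m x uv by (intro gram_pos pedersen_metric_bilinear pedersen_metric_commute pedersen_metric_pos)
  then have "(kaehler_form m x u v)\<^sup>2 / gram (pedersen_metric m x) u v \<le> 1"
    using kaehler_form_bound[OF uv(1)] by (simp add: divide_le_eq)
  from mult_left_mono[OF this, of "3 / 2 * weyl_coefficient m (x \<bullet> x)"] weyl_coefficient_nonneg
  show ?thesis
    unfolding K sectional_curvature_pedersen[OF uv] by simp
qed

text \<open>
  The plane spanned by \<open>u\<close> and \<open>I u\<close>: these are orthogonal of equal length, so \<open>\<Omega>\<^sup>2\<close> equals the Gram
  determinant.
\<close>

lemma complex_plane_curvature:
  "weyl_coefficient m (x \<bullet> x) - 4 \<in> sectional_curvatures (pedersen_metric m) x"
proof -
  define u :: "real ^ 4" where "u = axis 1 1"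
  define w where "w = almost_complex m x u"
  have u: "u \<noteq> 0" by (simp add: u_def axis_eq_0_iff)
  have N: "pedersen_metric m x u u > 0" by (rule pedersen_metric_pos[OF m x u])
  have orth: "pedersen_metric m x u w = 0"
    using metric_almost_complex[OF m x, of u u] pedersen_metric_commute[OF m, of x u w] by (simp add: w_def)
  have w: "pedersen_metric m x w w = pedersen_metric m x u u"
    unfolding w_def by (rule metric_almost_complex_self[OF m x])
  have indep: "\<forall>k. w \<noteq> k *\<^sub>R u"
  proof (intro allI notI)
    fix k assume k: "w = k *\<^sub>R u"
    then have "k * pedersen_metric m x u u = 0"
      using orth bilinear_rmul[OF pedersen_metric_bilinear[OF m]] by simp
    then show False using N k w bilinear_lzero[OF pedersen_metric_bilinear[OF m]] by simp
  qed
  have "kaehler_form m x u w = pedersen_metric m x u u"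
    using metric_almost_complex[OF m x, of u w] w by (simp add: w_def)
  then have "sectional_curvature (pedersen_metric m) x u w = weyl_coefficient m (x \<bullet> x) - 4"
    unfolding sectional_curvature_pedersen[OF u indep] gram_def w orth using N
    by (simp add: power2_eq_square)
  then show ?thesis
    using u indep independent_pair_iff[of u w] unfolding sectional_curvatures_def by force
qed

text \<open>
  The linear form \<open>\<Omega>(e\<^sub>1, \<cdot>)\<close> vanishes at some nonzero combination of \<open>e\<^sub>2\<close> and \<open>e\<^sub>3\<close>.
\<close>

lemma lagrangian_plane_curvature:
  "- (4 + weyl_coefficient m (x \<bullet> x) / 2) \<in> sectional_curvatures (pedersen_metric m) x"
proof -
  define e where "e i = (axis i 1 :: real ^ 4)" for i
  define v where "v = (if kaehler_form m x (e 1) (e 2) = 0 then e 2 else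
     kaehler_form m x (e 1) (e 2) *\<^sub>R e 3 - kaehler_form m x (e 1) (e 3) *\<^sub>R e 2)"
  have lin: "linear (kaehler_form m x u)" for u
    by (rule linearI) (simp_all add: kaehler_form_def inner_add_right add_divide_distrib[symmetric] algebra_simps)
  have "kaehler_form m x (e 1) v = 0"
    by (simp add: v_def linear_diff[OF lin] linear_cmul[OF lin])
  moreover have "e 1 \<noteq> 0" by (simp add: e_def axis_eq_0_iff)
  moreover have "\<forall>k. v \<noteq> k *\<^sub>R e 1"
  proof (intro allI notI)
    fix k assume k: "v = k *\<^sub>R e 1"
    have "v $ 1 = 0" "v $ 2 \<noteq> 0 \<or> v $ 3 \<noteq> 0"
      by (simp_all add: v_def e_def axis_def)
    with k show False by (simp add: e_def axis_def)
  qed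
  ultimately show ?thesis
    using sectional_curvature_pedersen[of "e 1" v] independent_pair_iff[of "e 1" v]
    unfolding sectional_curvatures_def by force
qed

end

lemma weyl_coefficient_less_4:
  assumes "0 \<le> m" "m < 1" "0 \<le> s" "s < 1"
  shows "weyl_coefficient m s < 4"
proof -
  have "0 < 1 + m * s" using assms by (intro pedersen_denominators)
  moreover have "1 - s \<le> 1 + m * s"
    using assms mult_nonneg_nonneg[of m s] by linarith
  ultimately have "0 \<le> (1 - s) / (1 + m * s)" "(1 - s) / (1 + m * s) \<le> 1"
    using assms by simp_all
  then have "((1 - s) / (1 + m * s)) ^ 3 \<le> 1" by (rule power_le_one)
  from mult_left_mono[OF this assms(1)] assms(2) show ?thesis
    by (simp add: weyl_coefficient_def)
qed

lemma eventually_weyl_coefficient_greater_4: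
  assumes "m > 1"
  shows "\<forall>\<^sub>F x :: real ^ 4 in nhds 0. weyl_coefficient m (x \<bullet> x) > 4"
proof -
  have "isCont (\<lambda>x :: real ^ 4. weyl_coefficient m (x \<bullet> x)) 0"
    unfolding weyl_coefficient_def by (intro continuous_intros) simp
  then have "((\<lambda>x :: real ^ 4. weyl_coefficient m (x \<bullet> x)) \<longlongrightarrow> weyl_coefficient m 0) (nhds 0)"
    using tendsto_at_iff_tendsto_nhds[of "\<lambda>x :: real ^ 4. weyl_coefficient m (x \<bullet> x)" 0]
    by (simp add: isCont_def)
  then show ?thesis
    by (rule order_tendstoD) (use assms in \<open>simp add: weyl_coefficient_def\<close>)
qed

theorem theorem12:
  fixes m2 :: real
  assumes "m2 \<ge> 0"
  shows "(negative_sectional_curvature_on (ball 0 1) (pedersen_metric m2) \<longleftrightarrow> m2 < 1) \<and>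
    (m2 > 1 \<longrightarrow>
      (\<forall>\<^sub>F x in nhds 0.
        (\<exists>K\<in>sectional_curvatures (pedersen_metric m2) x. K < 0) \<and>
        (\<exists>K\<in>sectional_curvatures (pedersen_metric m2) x. K > 0))) \<and>
    (m2 = 1 \<longrightarrow>
      (\<exists>K\<in>sectional_curvatures (pedersen_metric m2) 0. K < 0) \<and>
      (\<exists>K\<in>sectional_curvatures (pedersen_metric m2) 0. K = 0))"
proof (intro conjI impI iffI)
  have origin: "4 * m2 - 4 \<in> sectional_curvatures (pedersen_metric m2) 0"
    using complex_plane_curvature[OF assms, of 0] by (simp add: weyl_coefficient_def)
  have negative: "\<exists>K\<in>sectional_curvatures (pedersen_metric m2) x. K < 0" if "x \<in> ball 0 1" for x
    using lagrangian_plane_curvature[OF assms that] weyl_coefficient_nonneg[OF assms that]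
    by (intro bexI) simp_all
  show "m2 < 1" if "negative_sectional_curvature_on (ball 0 1) (pedersen_metric m2)"
    using that origin unfolding negative_sectional_curvature_on_def by force
  show "negative_sectional_curvature_on (ball 0 1) (pedersen_metric m2)" if "m2 < 1"
    unfolding negative_sectional_curvature_on_def
  proof (intro ballI)
    fix x K assume x: "x \<in> ball (0 :: real ^ 4) 1" and K: "K \<in> sectional_curvatures (pedersen_metric m2) x"
    have "weyl_coefficient m2 (x \<bullet> x) < 4"
      using assms that inner_self_less_1[OF x] by (intro weyl_coefficient_less_4) simp_all
    with sectional_curvatures_le[OF assms x K] show "K < 0" by simp
  qed
  show "\<forall>\<^sub>F x in nhds 0.
        (\<exists>K\<in>sectional_curvatures (pedersen_metric m2) x. K < 0) \<and>
        (\<exists>K\<in>sectional_curvatures (pedersen_metric m2) x. K > 0)" if "m2 > 1"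
  proof -
    have "\<forall>\<^sub>F x :: real ^ 4 in nhds 0. x \<in> ball 0 1"
      by (rule eventually_nhds_in_open) simp_all
    then show ?thesis
      using eventually_weyl_coefficient_greater_4[OF that]
    proof eventually_elim
      case (elim x)
      then show ?case
        by (intro conjI negative bexI[OF _ complex_plane_curvature[OF assms]]) simp_all
    qed
  qed
  show "\<exists>K\<in>sectional_curvatures (pedersen_metric m2) 0. K < 0"
    by (rule negative) simp
  show "\<exists>K\<in>sectional_curvatures (pedersen_metric m2) 0. K = 0" if "m2 = 1"
    using origin that by force
qed

end
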